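(* Fix $\tau$ in the upper half plane and constants $\tilde\nu_1,\tilde\nu_2,\tilde\nu_3\in\mathbb C$. On $\mathbb C^4$ with coordinates $(S_0,S_1,S_2,S_3)$ let $$\tilde L(z)=S_0\sigma_0+\sum_{\alpha=1}^3\bigl(S_\alpha\varphi_\alpha(z)+\tilde\nu_\alpha\varphi_\alpha(z-\omega_\alpha)\bigr)\sigma_\alpha ,\qquad r^\pm(z,w)=\sum_{\alpha=1}^3\varphi_\alpha(z\pm w)\,\sigma_\alpha\otimes\sigma_\alpha .$$ The classical reflection equation $$ \{\tilde L_1(z),\tilde L_2(w)\}_2=\tfrac12[\tilde L_1(z)\tilde L_2(w),r^-(z,w)]+\tfrac12\tilde L_2(w)r^+(z,w)\tilde L_1(z)-\tfrac12\tilde L_1(z)r^+(z,w)\tilde L_2(w) $$ (identically in $z,w$) defines a quadratic Poisson structure on $\mathbb C^4$, given by $$ \{S_\alpha,S_\beta\}_2=2i\sum_{\gamma}\varepsilon_{\alpha\beta\gamma}S_0S_\gamma, $$ $$ \{S_0,S_\alpha\}_2=\sum_{\beta,\gamma}\Bigl(i\,\varepsilon_{\alpha\beta\gamma}S_\beta S_\gamma\bigl(E_2(\omega_\beta)-E_2(\omega_\gamma)\bigr)+2i\,\varepsilon_{\alpha\beta\gamma}S_\beta\nu'_\gamma\Bigr), $$ where $\alpha,\beta,\gamma$ range over $1,2,3$ and $$\nu'_\alpha=-\tilde\nu_\alpha\exp(-2\pi i\,\omega_\alpha\partial_\tau\omega_\alpha)\left(\frac{\vartheta'(0)}{\vartheta(\omega_\alpha)}\right)^2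 .$$
   Context: $\omega_1=\frac12$, $\omega_2=\frac\tau2$, $\omega_3=\frac{1+\tau}2$; $\partial_\tau\omega_1=0$, $\partial_\tau\omega_2=\partial_\tau\omega_3=\frac12$. $\sigma_0$ is the identity, $\sigma_1,\sigma_2,\sigma_3$ the Pauli matrices; $\varepsilon_{\alpha\beta\gamma}$ is the Levi-Civita symbol. $\vartheta(z)=\sum_{j\in\mathbb Z}\exp\bigl(\pi i(j+\frac12)^2\tau+2\pi i(j+\frac12)(z+\frac12)\bigr)$, $E_2(z)=-\partial_z^2\log\vartheta(z)$, $$\phi(u,z)=\frac{\vartheta(u+z)\vartheta'(0)}{\vartheta(u)\vartheta(z)},\qquad \varphi_\alpha(z)=\exp(2\pi i z\,\partial_\tau\omega_\alpha)\,\phi(z,\omega_\alpha).$$ $\tilde L_1=\tilde L\otimes\sigma_0$, $\tilde L_2=\sigma_0\otimes\tilde L$, and $\{\tilde L_1(z),\tilde L_2(w)\}$ is the $4\times4$ matrix of Poisson brackets of the entries of $\tilde L(z)$ with those of $\tilde L(w)$. *)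

theory Defs
  imports "HOL-Analysis.Analysis"
begin

text \<open>
  Indices live in the four-element type \<^typ>\<open>4\<close>, whose elements are 0, 1, 2, 3. Greek indices of the
  formulas range over \<open>{1, 2, 3}\<close>; families such as the half-periods and the constants
  \<open>\<nu>\<close> are only ever used at those three values.
\<close>

section \<open>Theta function and elliptic functions\<close>

definition theta :: "complex \<Rightarrow> complex \<Rightarrow> complex" where
  "theta \<tau> z = (\<Sum>\<^sub>\<infinity>j\<in>(UNIV :: int set).
     exp (of_real pi * \<i> * (of_int j + 1/2)\<^sup>2 * \<tau>
          + 2 * of_real pi * \<i> * (of_int j + 1/2) * (z + 1/2)))"

text \<open>
  \<open>-\<partial>\<^sup>2 log \<theta>\<close>, the first derivative of \<open>log \<theta>\<close> being the logarithmic derivative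
  \<open>\<theta>'/\<theta>\<close>, so that no branch of the logarithm enters.
\<close>
definition E2 :: "complex \<Rightarrow> complex \<Rightarrow> complex" where
  "E2 \<tau> z = - deriv (\<lambda>x. deriv (theta \<tau>) x / theta \<tau> x) z"

definition phi :: "complex \<Rightarrow> complex \<Rightarrow> complex \<Rightarrow> complex" where
  "phi \<tau> u z = theta \<tau> (u + z) * deriv (theta \<tau>) 0 / (theta \<tau> u * theta \<tau> z)"

definition omega :: "complex \<Rightarrow> 4 \<Rightarrow> complex" where
  "omega \<tau> \<alpha> = (if \<alpha> = 1 then 1/2 else if \<alpha> = 2 then \<tau>/2 else if \<alpha> = 3 then (1 + \<tau>)/2 else 0)"

definition d_omega :: "complex \<Rightarrow> 4 \<Rightarrow> complex" where
  "d_omega \<tau> \<alpha> = deriv (\<lambda>t. omega t \<alpha>) \<tau>"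

definition varphi :: "complex \<Rightarrow> 4 \<Rightarrow> complex \<Rightarrow> complex" where
  "varphi \<tau> \<alpha> z = exp (2 * of_real pi * \<i> * z * d_omega \<tau> \<alpha>) * phi \<tau> z (omega \<tau> \<alpha>)"

definition nu' :: "complex \<Rightarrow> (4 \<Rightarrow> complex) \<Rightarrow> 4 \<Rightarrow> complex" where
  "nu' \<tau> \<nu> \<alpha> = - \<nu> \<alpha> * exp (- 2 * of_real pi * \<i> * omega \<tau> \<alpha> * d_omega \<tau> \<alpha>)
                 * (deriv (theta \<tau>) 0 / theta \<tau> (omega \<tau> \<alpha>))\<^sup>2"

definition levi_civita :: "4 \<Rightarrow> 4 \<Rightarrow> 4 \<Rightarrow> complex" where
  "levi_civita \<alpha> \<beta> \<gamma> =
     (if (\<alpha>, \<beta>, \<gamma>) \<in> {(1, 2, 3), (2, 3, 1), (3, 1, 2)} then 1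
      else if (\<alpha>, \<beta>, \<gamma>) \<in> {(3, 2, 1), (2, 1, 3), (1, 3, 2)} then - 1
      else 0)"

section \<open>Matrices\<close>

definition cscale :: "complex \<Rightarrow> complex ^ 'n ^ 'm \<Rightarrow> complex ^ 'n ^ 'm"  (infixr "*\<^sub>m" 75) where
  "c *\<^sub>m A = (\<chi> i j. c * A $ i $ j)"

definition kron :: "complex ^ 2 ^ 2 \<Rightarrow> complex ^ 2 ^ 2 \<Rightarrow> complex ^ (2 \<times> 2) ^ (2 \<times> 2)"  (infixl "\<otimes>" 70)
  where "A \<otimes> B = (\<chi> p q. A $ fst p $ fst q * B $ snd p $ snd q)"

definition commutator :: "complex ^ 'n ^ 'n \<Rightarrow> complex ^ 'n ^ 'n \<Rightarrow> complex ^ 'n ^ 'n" where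
  "commutator A B = A ** B - B ** A"

definition pauli :: "4 \<Rightarrow> complex ^ 2 ^ 2" where
  "pauli \<alpha> = (if \<alpha> = 0 then mat 1
              else if \<alpha> = 1 then vector [vector [0, 1], vector [1, 0]]
              else if \<alpha> = 2 then vector [vector [0, - \<i>], vector [\<i>, 0]]
              else vector [vector [1, 0], vector [0, - 1]])"

section \<open>Poisson structures on \<open>\<complex>\<^sup>4\<close>\<close>

text \<open>
  The coordinate ring of \<open>\<complex>\<^sup>4\<close>, as functions. A bracket is an operation on this ring; what it does
  to functions outside of the ring is irrelevant.
\<close>
inductive_set polyfuns :: "(complex ^ 4 \<Rightarrow> complex) set" where
  const: "(\<lambda>S. c) \<in> polyfuns"
| coord: "(\<lambda>S. S $ a) \<in> polyfuns"
| add: "f \<in> polyfuns \<Longrightarrow> g \<in> polyfuns \<Longrightarrow> (\<lambda>S. f S + g S) \<in> polyfuns"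
| mult: "f \<in> polyfuns \<Longrightarrow> g \<in> polyfuns \<Longrightarrow> (\<lambda>S. f S * g S) \<in> polyfuns"

type_synonym bracket =
  "(complex ^ 4 \<Rightarrow> complex) \<Rightarrow> (complex ^ 4 \<Rightarrow> complex) \<Rightarrow> (complex ^ 4 \<Rightarrow> complex)"

text \<open>Linearity and the Leibniz rule in the second argument follow from skew-symmetry.\<close>
definition skew_biderivation :: "bracket \<Rightarrow> bool" where
  "skew_biderivation P \<longleftrightarrow>
     (\<forall>f\<in>polyfuns. \<forall>g\<in>polyfuns. P f g \<in> polyfuns) \<and>
     (\<forall>f\<in>polyfuns. \<forall>g\<in>polyfuns. \<forall>S. P f g S = - P g f S) \<and>
     (\<forall>f\<in>polyfuns. \<forall>g\<in>polyfuns. \<forall>h\<in>polyfuns. \<forall>S. P (\<lambda>x. f x + g x) h S = P f h S + P g h S) \<and>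
     (\<forall>c. \<forall>f\<in>polyfuns. \<forall>h\<in>polyfuns. \<forall>S. P (\<lambda>x. c * f x) h S = c * P f h S) \<and>
     (\<forall>f\<in>polyfuns. \<forall>g\<in>polyfuns. \<forall>h\<in>polyfuns. \<forall>S.
        P (\<lambda>x. f x * g x) h S = f S * P g h S + P f h S * g S)"

definition poisson_bracket :: "bracket \<Rightarrow> bool" where
  "poisson_bracket P \<longleftrightarrow>
     skew_biderivation P \<and>
     (\<forall>f\<in>polyfuns. \<forall>g\<in>polyfuns. \<forall>h\<in>polyfuns. \<forall>S.
        P f (P g h) S + P g (P h f) S + P h (P f g) S = 0)"

text \<open>
  Brackets of coordinates are polynomials of degree at most two; they need not be homogeneous
  (the parameters \<open>\<nu>\<close> contribute linear terms).
\<close>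
definition quadratic_bracket :: "bracket \<Rightarrow> bool" where
  "quadratic_bracket P \<longleftrightarrow>
     (\<forall>a b. \<exists>(q :: 4 \<Rightarrow> 4 \<Rightarrow> complex) (l :: 4 \<Rightarrow> complex) (k :: complex). \<forall>S.
        P (\<lambda>x. x $ a) (\<lambda>x. x $ b) S
          = (\<Sum>c\<in>UNIV. \<Sum>d\<in>UNIV. q c d * S $ c * S $ d) + (\<Sum>c\<in>UNIV. l c * S $ c) + k)"

section \<open>The classical reflection equation\<close>

definition lax :: "complex \<Rightarrow> (4 \<Rightarrow> complex) \<Rightarrow> complex \<Rightarrow> complex ^ 4 \<Rightarrow> complex ^ 2 ^ 2" where
  "lax \<tau> \<nu> z S = S $ 0 *\<^sub>m pauli 0
     + (\<Sum>\<alpha>\<in>{1, 2, 3}. (S $ \<alpha> * varphi \<tau> \<alpha> z + \<nu> \<alpha> * varphi \<tau> \<alpha> (z - omega \<tau> \<alpha>)) *\<^sub>m pauli \<alpha>)"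

definition r_minus :: "complex \<Rightarrow> complex \<Rightarrow> complex \<Rightarrow> complex ^ (2 \<times> 2) ^ (2 \<times> 2)" where
  "r_minus \<tau> z w = (\<Sum>\<alpha>\<in>{1, 2, 3}. varphi \<tau> \<alpha> (z - w) *\<^sub>m (pauli \<alpha> \<otimes> pauli \<alpha>))"

definition r_plus :: "complex \<Rightarrow> complex \<Rightarrow> complex \<Rightarrow> complex ^ (2 \<times> 2) ^ (2 \<times> 2)" where
  "r_plus \<tau> z w = (\<Sum>\<alpha>\<in>{1, 2, 3}. varphi \<tau> \<alpha> (z + w) *\<^sub>m (pauli \<alpha> \<otimes> pauli \<alpha>))"

text \<open>
  The matrix \<open>{M\<^sub>1, N\<^sub>2}\<close>: its entry at \<open>((i, k), (j, l))\<close> is \<open>{M\<^sub>i\<^sub>j, N\<^sub>k\<^sub>l}\<close>, in accordance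
  with the index convention of the Kronecker product.
\<close>
definition bracket_matrix ::
  "bracket \<Rightarrow> (complex ^ 4 \<Rightarrow> complex ^ 2 ^ 2) \<Rightarrow> (complex ^ 4 \<Rightarrow> complex ^ 2 ^ 2)
     \<Rightarrow> complex ^ 4 \<Rightarrow> complex ^ (2 \<times> 2) ^ (2 \<times> 2)" where
  "bracket_matrix P M N S =
     (\<chi> p q. P (\<lambda>x. M x $ fst p $ fst q) (\<lambda>x. N x $ snd p $ snd q) S)"

text \<open>
  None of the functions of \<open>z\<close> and \<open>w\<close> in the reflection equation is evaluated where a denominator
  vanishes (the remaining denominators \<open>\<theta>(\<omega>\<^sub>\<alpha>)\<close> are constants).
\<close>
definition off_poles :: "complex \<Rightarrow> complex \<Rightarrow> complex \<Rightarrow> bool" where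
  "off_poles \<tau> z w \<longleftrightarrow>
     theta \<tau> z \<noteq> 0 \<and> theta \<tau> w \<noteq> 0 \<and> theta \<tau> (z - w) \<noteq> 0 \<and> theta \<tau> (z + w) \<noteq> 0 \<and>
     (\<forall>\<alpha>\<in>{1, 2, 3}. theta \<tau> (z - omega \<tau> \<alpha>) \<noteq> 0 \<and> theta \<tau> (w - omega \<tau> \<alpha>) \<noteq> 0)"

definition reflection_equation :: "complex \<Rightarrow> (4 \<Rightarrow> complex) \<Rightarrow> bracket \<Rightarrow> bool" where
  "reflection_equation \<tau> \<nu> P \<longleftrightarrow>
     (\<forall>z w S. off_poles \<tau> z w \<longrightarrow>
        (let L1 = lax \<tau> \<nu> z S \<otimes> pauli 0; L2 = pauli 0 \<otimes> lax \<tau> \<nu> w S in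
         bracket_matrix P (lax \<tau> \<nu> z) (lax \<tau> \<nu> w) S =
           (1/2) *\<^sub>m commutator (L1 ** L2) (r_minus \<tau> z w)
           + (1/2) *\<^sub>m (L2 ** r_plus \<tau> z w ** L1)
           - (1/2) *\<^sub>m (L1 ** r_plus \<tau> z w ** L2)))"

end

(*
  All elliptic functions are reduced to the three-term theta relation. Rearranging the double
  series gives theta(x + y) theta(x - y) = A(x) B(y) - B(x) A(y), where A, B are theta series of
  modulus 2 tau; the three-term relation is the Pluecker relation of such 2x2 determinants. Its
  second derivative expresses E2(x) - E2(y) through theta, and its specialisation at half-periods
  is an addition formula for phi_alpha(z + w) in terms of phi_beta(z), phi_beta(w). With
  phi_alpha(z)^2 = E2(z) - E2(omega_alpha) and
  nu_alpha phi_alpha(z - omega_alpha) = nu'_alpha / phi_alpha(z), the reflection equation becomes,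
  component by component in the basis sigma_a x sigma_b, an algebraic identity, equivalent to the
  bracket formulas wherever phi_alpha(z), phi_alpha(w) do not vanish.

  That theta'(0) and theta(omega_alpha) do not vanish also follows from the determinant formula:
  theta'(0) = 0 would kill the Wronskian of A and B, and theta(omega_alpha) = 0 would give
  AB = 0 or A^2 = B^2 or A^2 = -B^2.
*)
theory Submission
  imports Defs "HOL-Complex_Analysis.Conformal_Mappings"
begin

section \<open>Gaussian series\<close>

text \<open>Why the equation closes on a bracket free of z and w: after multiplication by D = E2(w)
  - E2(z), the values of varphi_\<alpha> at z + w and z - w become the difference and the sum of the
  same two triple products, because varphi_\<alpha> is odd and E2 is even. A Pauli component
  contains only sums and differences of such values, so each collapses to a single triple product.
  Its factors clear the quotients nu' / varphi and leave expressions affine in E2(z) and in E2(w),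
  from which D divides out. Besides the constants whose nonvanishing is established, genericity
  comes from countability: admissible z, w avoid finitely many countable zero sets. One such pair
  already determines all brackets of coordinates. The Jacobi identity is not drawn from the
  reflection equation. The bracket is built from a bivector field with free parameters in place of
  E2(omega_\<alpha>) and nu'_\<alpha>; the identity is checked on coordinates and carried to all
  polynomials by the derivation property.\<close>

lemma has_sum_product:
  fixes f :: "'a \<Rightarrow> complex" and g :: "'b \<Rightarrow> complex"
  assumes f: "(\<lambda>x. norm (f x)) summable_on A" and g: "(\<lambda>y. norm (g y)) summable_on B"
  shows "((\<lambda>(x, y). f x * g y) has_sum (infsum f A * infsum g B)) (A \<times> B)"
proof (rule has_sum_SigmaI)
  show "((\<lambda>y. case (x, y) of (x, y) \<Rightarrow> f x * g y) has_sum f x * infsum g B) B" for x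
    using has_sum_cmult_right[OF has_sum_infsum[OF abs_summable_summable[OF g]]] by simp
  show "((\<lambda>x. f x * infsum g B) has_sum infsum f A * infsum g B) A"
    by (rule has_sum_cmult_left[OF has_sum_infsum[OF abs_summable_summable[OF f]]])
  have "(\<lambda>(x, y). norm (f x) * norm (g y)) summable_on A \<times> B"
  proof (rule summable_on_SigmaI)
    show "((\<lambda>y. case (x, y) of (x, y) \<Rightarrow> norm (f x) * norm (g y)) has_sum
             norm (f x) * infsum (\<lambda>y. norm (g y)) B) B" for x
      using has_sum_cmult_right[OF has_sum_infsum[OF g]] by simp
    show "(\<lambda>x. norm (f x) * infsum (\<lambda>y. norm (g y)) B) summable_on A"
      by (rule summable_on_cmult_left[OF f])
  qed auto
  then have "(\<lambda>p. norm (case p of (x, y) \<Rightarrow> f x * g y)) summable_on A \<times> B"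
    by (simp add: split_def norm_mult)
  then show "(\<lambda>(x, y). f x * g y) summable_on A \<times> B"
    by (rule abs_summable_summable)
qed

text \<open>The half-integers j + 1/2 become m / 2 with m = 2 j + 1 odd, and parity moves into the
  index set \<open>M\<close>. One estimate then serves theta and the two series of modulus 2 \<tau>
  over the even and the odd integers.\<close>

definition gauss_series :: "int set \<Rightarrow> complex \<Rightarrow> complex \<Rightarrow> complex" where
  "gauss_series M c z = (\<Sum>\<^sub>\<infinity>m\<in>M. exp (c * of_int m ^ 2 + of_real pi * \<i> * of_int m * z))"

lemma summable_on_exp_neg_abs: "(\<lambda>m::int. exp (- \<bar>real_of_int m\<bar>)) summable_on UNIV"
proof -
  have nat: "(\<lambda>n::nat. exp (- real n)) summable_on UNIV"
  proof -
    have "summable (\<lambda>n::nat. exp (- 1 :: real) ^ n)"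
      by (rule summable_geometric) simp
    then have "summable (\<lambda>n::nat. exp (- real n))"
      by (simp add: exp_of_nat_mult[symmetric])
    then show ?thesis
      by (intro norm_summable_imp_summable_on) simp
  qed
  have "(\<lambda>m::int. exp (- \<bar>real_of_int m\<bar>)) summable_on range int"
    using nat by (subst summable_on_reindex) (auto simp: o_def)
  moreover have "(\<lambda>m::int. exp (- \<bar>real_of_int m\<bar>)) summable_on range (\<lambda>n. - int n)"
    using nat by (subst summable_on_reindex) (auto simp: o_def inj_on_def)
  ultimately have "(\<lambda>m::int. exp (- \<bar>real_of_int m\<bar>)) summable_on (range int \<union> range (\<lambda>n. - int n))"
    by (rule summable_on_union)
  moreover have "range int \<union> range (\<lambda>n. - int n) = UNIV"
  proof -
    have "m \<in> range int \<union> range (\<lambda>n. - int n)" for m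
      by (cases m rule: int_cases2) auto
    then show ?thesis by blast
  qed
  ultimately show ?thesis by simp
qed

text \<open>Completing the square: the Gaussian decay absorbs the growth exp(pi R |m|) with a factor
  exp(|m|) to spare. That spare factor is the 1 in \<open>pi * R + 1\<close>; it leaves a summable
  majorant common to all z in the disc.\<close>

lemma norm_gauss_term_le:
  fixes c z :: complex
  assumes "Re c < 0" and "norm z \<le> R"
  shows "norm (exp (c * of_int m ^ 2 + of_real pi * \<i> * of_int m * z))
           \<le> exp ((pi * R + 1)\<^sup>2 / (4 * (- Re c))) * exp (- \<bar>real_of_int m\<bar>)"
proof -
  define a x b where "a = - Re c" and "x = \<bar>real_of_int m\<bar>" and "b = pi * R + 1"
  have a: "a > 0" using assms by (simp add: a_def)
  have "- (real_of_int m * Im z) \<le> x * R"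
  proof -
    have "- (real_of_int m * Im z) \<le> \<bar>real_of_int m * Im z\<bar>" by simp
    also have "\<dots> \<le> x * R"
      unfolding abs_mult x_def using abs_Im_le_cmod[of z] assms(2) by (intro mult_left_mono) auto
    finally show ?thesis .
  qed
  then have "- (pi * (real_of_int m * Im z)) \<le> pi * (x * R)"
    using mult_left_mono[of "- (real_of_int m * Im z)" "x * R" pi] by simp
  moreover have "b * x \<le> a * x\<^sup>2 + b\<^sup>2 / (4 * a)"
  proof -
    have "0 \<le> (2 * a * x - b)\<^sup>2 / (4 * a)" using a by simp
    also have "\<dots> = a * x\<^sup>2 - b * x + b\<^sup>2 / (4 * a)"
      using a by (simp add: field_simps power2_eq_square)
    finally show ?thesis by simp
  qed
  moreover have "Re (c * of_int m ^ 2) = - a * x\<^sup>2"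
    by (simp add: a_def x_def power2_eq_square)
  moreover have "Re (of_real pi * \<i> * of_int m * z) = - (pi * (real_of_int m * Im z))"
    by simp
  ultimately have "Re (c * of_int m ^ 2 + of_real pi * \<i> * of_int m * z) \<le> b\<^sup>2 / (4 * a) + - x"
    unfolding b_def plus_complex.sel by (simp add: algebra_simps)
  then show ?thesis
    unfolding norm_exp_eq_Re a_def[symmetric] b_def[symmetric] x_def[symmetric] exp_add[symmetric]
    by simp
qed

lemma summable_on_gauss_bound:
  "(\<lambda>m. K * exp (- \<bar>real_of_int m\<bar>)) summable_on M"
  by (intro summable_on_cmult_right summable_on_subset_banach[OF summable_on_exp_neg_abs]) auto

lemma gauss_abs_summable:
  assumes "Re c < 0"
  shows "(\<lambda>m. norm (exp (c * of_int m ^ 2 + of_real pi * \<i> * of_int m * z))) summable_on M"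
  by (rule summable_on_comparison_test[OF summable_on_gauss_bound])
     (use norm_gauss_term_le[OF assms order_refl[of "norm z"]] in auto)

lemma uniform_limit_gauss_series:
  assumes "Re c < 0"
  shows "uniform_limit (cball 0 R)
           (\<lambda>F z. \<Sum>m\<in>F. exp (c * of_int m ^ 2 + of_real pi * \<i> * of_int m * z))
           (gauss_series M c) (finite_subsets_at_top M)"
  unfolding gauss_series_def
  by (rule Weierstrass_m_test_general[OF _ summable_on_gauss_bound], rule norm_gauss_term_le[OF assms])
     simp

lemma gauss_series_holomorphic:
  assumes "Re c < 0"
  shows "gauss_series M c holomorphic_on UNIV"
proof -
  have "gauss_series M c holomorphic_on ball 0 R" for R
    by (rule holomorphic_uniform_limit[OF _ uniform_limit_gauss_series[OF assms, of R M]])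
       (auto intro!: always_eventually continuous_intros holomorphic_intros)
  then have "gauss_series M c field_differentiable at z" for z
    by (rule holomorphic_on_imp_differentiable_at[of _ "ball 0 (norm z + 1)"]) auto
  then show ?thesis
    by (simp add: holomorphic_on_def)
qed

text \<open>The Fourier coefficient at \<open>k\<close> is obtained by integrating over a period.\<close>
lemma gauss_series_not_identically_zero:
  assumes "Re c < 0" and k: "k \<in> M"
  shows "\<exists>z. gauss_series M c z \<noteq> 0"
proof (rule ccontr)
  assume "\<not> ?thesis"
  then have zero: "gauss_series M c = (\<lambda>z. 0)" by auto
  \<comment> \<open>On the real line exp(- pi \<i> k x) has modulus 1, so the partial sums still
    tend to 0 uniformly. All frequencies are multiples of pi, hence the interval of length
    2.\<close>
  define g where "g F x = (\<Sum>m\<in>F. exp (c * of_int m ^ 2 + of_real pi * \<i> * of_int m * of_real x))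
    * exp (- (of_real pi * \<i> * of_int k * of_real x))" for F :: "int set" and x :: real
  have "uniform_limit {0..2::real}
           (\<lambda>F x. \<Sum>m\<in>F. exp (c * of_int m ^ 2 + of_real pi * \<i> * of_int m * of_real x))
           (\<lambda>x. gauss_series M c (of_real x)) (finite_subsets_at_top M)"
    by (rule uniform_limit_compose'[OF uniform_limit_gauss_series[OF assms(1), of 2]]) auto
  then have "uniform_limit {0..2::real}
           (\<lambda>F x. \<Sum>m\<in>F. exp (c * of_int m ^ 2 + of_real pi * \<i> * of_int m * of_real x))
           (\<lambda>x. 0) (finite_subsets_at_top M)"
    by (simp add: zero)
  then have ul: "uniform_limit {0..2::real} g (\<lambda>x. 0) (finite_subsets_at_top M)"
    unfolding uniform_limit_iff g_def by (simp add: norm_mult dist_norm)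
  obtain I J where I: "\<And>F. (g F has_integral I F) {0..2}" and J: "((\<lambda>x. 0) has_integral J) {0..2::real}"
    and lim: "(I \<longlongrightarrow> J) (finite_subsets_at_top M)"
    by (rule uniform_limit_integral[OF ul]) (auto simp: g_def intro!: continuous_intros)
  have "J = 0" using J by (simp add: has_integral_0_eq)
  have term_integral: "((\<lambda>x. exp (of_real pi * \<i> * of_int n * of_real x)) has_integral
      (if n = 0 then 2 else 0)) {0..2::real}" for n :: int
  proof (cases "n = 0")
    case True
    then show ?thesis using has_integral_const_real[of "1::complex" 0 2] by (simp add: scaleR_conv_of_real)
  next
    case False
    define w where "w = of_real pi * \<i> * of_int n"
    have w: "w \<noteq> 0" using False by (simp add: w_def)
    have "((\<lambda>x. exp (w * of_real x)) has_integral exp (w * of_real 2) / w - exp (w * of_real 0) / w) {0..2::real}"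
    proof (rule fundamental_theorem_of_calculus)
      fix x :: real
      have "((\<lambda>z. exp (w * z) / w) has_field_derivative exp (w * of_real x)) (at (of_real x))"
        using w by (auto intro!: derivative_eq_intros)
      then show "((\<lambda>x. exp (w * of_real x) / w) has_vector_derivative exp (w * of_real x)) (at x within {0..2})"
        by (rule has_vector_derivative_real_field)
    qed simp
    moreover have "exp (w * 2) = 1"
      unfolding w_def using exp_integer_2pi[of "of_int n"] by (simp add: algebra_simps)
    ultimately show ?thesis using False by (simp add: w_def)
  qed
  have IF: "I F = 2 * exp (c * of_int k ^ 2)" if F: "finite F" "k \<in> F" for F
  proof -
    have "((\<lambda>x. \<Sum>m\<in>F. exp (c * of_int m ^ 2) * exp (of_real pi * \<i> * of_int (m - k) * of_real x))
       has_integral (\<Sum>m\<in>F. exp (c * of_int m ^ 2) * (if m - k = 0 then 2 else 0))) {0..2::real}"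
      by (intro has_integral_sum F has_integral_mult_right term_integral)
    moreover have "(\<lambda>x. \<Sum>m\<in>F. exp (c * of_int m ^ 2) * exp (of_real pi * \<i> * of_int (m - k) * of_real x)) = g F"
      unfolding g_def sum_distrib_right exp_add[symmetric]
      by (intro ext sum.cong refl arg_cong[of _ _ exp]) (simp add: algebra_simps)
    moreover have "(\<Sum>m\<in>F. exp (c * of_int m ^ 2) * (if m - k = 0 then 2 else 0)) = 2 * exp (c * of_int k ^ 2)"
      using F by (simp add: if_distrib[of "\<lambda>t. _ * t"] sum.delta' cong: if_cong)
    ultimately have "(g F has_integral 2 * exp (c * of_int k ^ 2)) {0..2}" by simp
    then show ?thesis using I has_integral_unique by blast
  qed
  \<comment> \<open>The integral is constant once \<open>F\<close> contains \<open>k\<close>; its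
    limit is twice a value of exp, which contradicts \<open>J = 0\<close>.\<close>
  have "eventually (\<lambda>F. I F = 2 * exp (c * of_int k ^ 2)) (finite_subsets_at_top M)"
    unfolding eventually_finite_subsets_at_top using k IF by (intro exI[of _ "{k}"]) auto
  then have "(I \<longlongrightarrow> 2 * exp (c * of_int k ^ 2)) (finite_subsets_at_top M)"
    using tendsto_eventually by blast
  then have "J = 2 * exp (c * of_int k ^ 2)"
    using tendsto_unique[OF _ lim] by auto
  with \<open>J = 0\<close> show False by simp
qed

section \<open>The three-term theta relation\<close>

lemma theta_eq_gauss_series:
  "theta \<tau> z = gauss_series {m. odd m} (of_real pi * \<i> * \<tau> / 4) (z + 1/2)"
proof -
  have "theta \<tau> z = (\<Sum>\<^sub>\<infinity>m\<in>{m::int. odd m}. exp (of_real pi * \<i> * \<tau> / 4 * of_int m ^ 2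
          + of_real pi * \<i> * of_int m * (z + 1/2)))"
    unfolding theta_def
  proof (rule infsum_reindex_bij_witness[of _ "\<lambda>m. m div 2" "\<lambda>j. 2 * j + 1"])
    fix j :: int
    show "exp (of_real pi * \<i> * \<tau> / 4 * of_int (2 * j + 1) ^ 2
            + of_real pi * \<i> * of_int (2 * j + 1) * (z + 1/2))
        = exp (of_real pi * \<i> * (of_int j + 1/2)\<^sup>2 * \<tau> + 2 * of_real pi * \<i> * (of_int j + 1/2) * (z + 1/2))"
      by (rule arg_cong[of _ _ exp]) (simp add: field_simps power2_eq_square)
  qed auto
  then show ?thesis by (simp add: gauss_series_def)
qed

lemma
  assumes "Im \<tau> > 0"
  shows Re_theta_coeff: "Re (of_real pi * \<i> * \<tau> / 4) < 0"
    and Re_theta_coeff2: "Re (of_real pi * \<i> * \<tau> / 2) < 0"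
  using assms by auto

lemma theta_holomorphic:
  assumes "Im \<tau> > 0"
  shows "theta \<tau> holomorphic_on UNIV"
proof -
  have "(gauss_series {m. odd m} (of_real pi * \<i> * \<tau> / 4) \<circ> (\<lambda>z. z + 1/2)) holomorphic_on UNIV"
    by (rule holomorphic_on_compose_gen[OF _ gauss_series_holomorphic[OF Re_theta_coeff[OF assms]]])
       (auto intro!: holomorphic_intros)
  then show ?thesis by (simp add: o_def theta_eq_gauss_series[abs_def])
qed

lemma theta_not_identically_zero:
  assumes "Im \<tau> > 0"
  shows "\<exists>z. theta \<tau> z \<noteq> 0"
proof -
  obtain u where "gauss_series {m. odd m} (of_real pi * \<i> * \<tau> / 4) u \<noteq> 0"
    using gauss_series_not_identically_zero[OF Re_theta_coeff[OF assms], of 1 "{m. odd m}"] by auto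
  then have "theta \<tau> (u - 1/2) \<noteq> 0" by (simp add: theta_eq_gauss_series)
  then show ?thesis by blast
qed

lemma gauss_series_shift_multiplier:
  assumes "\<And>m. m \<in> M \<Longrightarrow> exp (of_real pi * \<i> * of_int m * t) = s"
  shows "gauss_series M c (z + t) = s * gauss_series M c z"
proof -
  have "gauss_series M c (z + t)
      = (\<Sum>\<^sub>\<infinity>m\<in>M. s * exp (c * of_int m ^ 2 + of_real pi * \<i> * of_int m * z))"
    unfolding gauss_series_def
    by (intro infsum_cong) (simp add: assms[symmetric] exp_add[symmetric] algebra_simps)
  then show ?thesis
    by (simp add: gauss_series_def infsum_cmult_right')
qed

text \<open>Since c (m + k)^2 = c m^2 + 2 c k m + c k^2, translating the index by k amounts to
  translating z by t with pi \<i> t = 2 c k. The parity of k decides whether \<open>M'\<close> is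
  \<open>M\<close> again (k = 2, quasi-periodicity of theta) or the other parity class (k = 1,
  exchange of \<open>theta_even\<close> and \<open>theta_odd\<close>).\<close>

lemma gauss_series_shift_coeff:
  assumes "bij_betw (\<lambda>m. m + k) M M'" and "of_real pi * \<i> * t = 2 * c * of_int k"
  shows "gauss_series M c (z + t)
           = exp (- c * of_int k ^ 2 - of_real pi * \<i> * of_int k * z) * gauss_series M' c z"
proof -
  have "gauss_series M c (z + t)
      = (\<Sum>\<^sub>\<infinity>m\<in>M. exp (- c * of_int k ^ 2 - of_real pi * \<i> * of_int k * z) *
            exp (c * of_int (m + k) ^ 2 + of_real pi * \<i> * of_int (m + k) * z))"
    unfolding gauss_series_def
  proof (intro infsum_cong)
    fix m
    have t: "of_real pi * \<i> * of_int m * (z + t) = of_real pi * \<i> * of_int m * z + of_int m * (2 * c * of_int k)"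
      unfolding assms(2)[symmetric] by (simp add: algebra_simps)
    show "exp (c * of_int m ^ 2 + of_real pi * \<i> * of_int m * (z + t)) =
       exp (- c * of_int k ^ 2 - of_real pi * \<i> * of_int k * z) *
            exp (c * of_int (m + k) ^ 2 + of_real pi * \<i> * of_int (m + k) * z)"
      unfolding t exp_add[symmetric]
      by (rule arg_cong[of _ _ exp]) (simp add: algebra_simps power2_eq_square)
  qed
  also have "\<dots> = exp (- c * of_int k ^ 2 - of_real pi * \<i> * of_int k * z) * gauss_series M' c z"
    unfolding gauss_series_def infsum_cmult_right' 
    by (subst infsum_reindex_bij_betw[OF assms(1)]) simp
  finally show ?thesis .
qed

lemma bij_betw_add_int:
  fixes k :: int
  assumes "\<And>m. m + k \<in> M' \<longleftrightarrow> m \<in> M"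
  shows "bij_betw (\<lambda>m. m + k) M M'"
proof (rule bij_betw_byWitness[of _ "\<lambda>m. m - k"])
  show "(\<lambda>m. m + k) ` M \<subseteq> M'" using assms by blast
  show "(\<lambda>m. m - k) ` M' \<subseteq> M" using assms[of "_ - k"] by fastforce
qed auto

lemma exp_odd_pi_i: "odd m \<Longrightarrow> exp (of_real pi * \<i> * of_int m) = - 1"
  and exp_even_pi_i: "even m \<Longrightarrow> exp (of_real pi * \<i> * of_int m) = 1"
proof -
  have *: "exp (of_real pi * \<i> * of_int (2 * k)) = 1" for k
    using exp_integer_2pi[of "of_int k"] by (simp add: algebra_simps)
  show "even m \<Longrightarrow> exp (of_real pi * \<i> * of_int m) = 1" using * by (auto elim!: evenE)
  show "exp (of_real pi * \<i> * of_int m) = - 1" if odd: "odd m"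
  proof -
    obtain k where "m = 2 * k + 1" using odd by (elim oddE)
    then have "exp (of_real pi * \<i> * of_int m) = exp (of_real pi * \<i> * of_int (2 * k)) * exp (of_real pi * \<i>)"
      by (simp add: exp_add[symmetric] algebra_simps)
    then show ?thesis unfolding * by simp
  qed
qed

lemma theta_add_one: "theta \<tau> (z + 1) = - theta \<tau> z"
proof -
  have "gauss_series {m. odd m} (of_real pi * \<i> * \<tau> / 4) (z + 1/2 + 1)
      = - 1 * gauss_series {m. odd m} (of_real pi * \<i> * \<tau> / 4) (z + 1/2)"
    by (rule gauss_series_shift_multiplier) (simp add: exp_odd_pi_i)
  then show ?thesis by (simp add: theta_eq_gauss_series add_ac)
qed

lemma theta_add_tau: "theta \<tau> (z + \<tau>) = - exp (- of_real pi * \<i> * \<tau> - 2 * of_real pi * \<i> * z) * theta \<tau> z"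
proof -
  have "theta \<tau> (z + \<tau>) = gauss_series {m. odd m} (of_real pi * \<i> * \<tau> / 4) (z + 1/2 + \<tau>)"
    by (simp add: theta_eq_gauss_series add_ac)
  also have "\<dots> = exp (- (of_real pi * \<i> * \<tau> / 4) * of_int 2 ^ 2 - of_real pi * \<i> * of_int 2 * (z + 1/2)) * theta \<tau> z"
    unfolding theta_eq_gauss_series
    by (rule gauss_series_shift_coeff) (auto intro: bij_betw_add_int)
  also have "exp (- (of_real pi * \<i> * \<tau> / 4) * of_int 2 ^ 2 - of_real pi * \<i> * of_int 2 * (z + 1/2))
     = exp (- of_real pi * \<i> * \<tau> - 2 * of_real pi * \<i> * z) * exp (- (of_real pi * \<i>))"
    unfolding exp_add[symmetric] by (rule arg_cong[of _ _ exp]) (simp add: algebra_simps)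
  finally show ?thesis by (simp add: exp_minus)
qed

lemma theta_minus: "theta \<tau> (- z) = - theta \<tau> z"
proof -
  \<comment> \<open>The offset 1/2 is not preserved by negation: it costs a unit translation, and
    this is where the sign comes from.\<close>
  have "theta \<tau> (- z) = gauss_series {m. odd m} (of_real pi * \<i> * \<tau> / 4) (- (z + 1/2) + 1)"
    by (simp add: theta_eq_gauss_series)
  also have "\<dots> = - 1 * gauss_series {m. odd m} (of_real pi * \<i> * \<tau> / 4) (- (z + 1/2))"
    by (rule gauss_series_shift_multiplier) (simp add: exp_odd_pi_i)
  also have "gauss_series {m. odd m} (of_real pi * \<i> * \<tau> / 4) (- (z + 1/2)) = theta \<tau> z"
    unfolding theta_eq_gauss_series gauss_series_def
  proof (rule infsum_reindex_bij_witness[of _ uminus uminus])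
    fix m :: int
    show "exp (of_real pi * \<i> * \<tau> / 4 * of_int (- m) ^ 2 + of_real pi * \<i> * of_int (- m) * (z + 1/2))
        = exp (of_real pi * \<i> * \<tau> / 4 * of_int m ^ 2 + of_real pi * \<i> * of_int m * - (z + 1/2))"
      by (rule arg_cong[of _ _ exp]) (simp add: algebra_simps)
  qed auto
  finally show ?thesis by simp
qed

lemma theta_zero [simp]: "theta \<tau> 0 = 0"
  using theta_minus[of \<tau> 0] by simp

text \<open>
  In Jacobi's notation, \<open>\<theta>\<^sub>3(2x | 2\<tau>)\<close> and \<open>\<theta>\<^sub>2(2x | 2\<tau>)\<close>.
\<close>
definition theta_even :: "complex \<Rightarrow> complex \<Rightarrow> complex" where
  "theta_even \<tau> x = gauss_series {m. even m} (of_real pi * \<i> * \<tau> / 2) (2 * x)"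

definition theta_odd :: "complex \<Rightarrow> complex \<Rightarrow> complex" where
  "theta_odd \<tau> x = gauss_series {m. odd m} (of_real pi * \<i> * \<tau> / 2) (2 * x)"

text \<open>
  The double series is rearranged by \<open>m = j + k + 1\<close>, \<open>n = j - k\<close>, which turns the index set into
  the pairs of opposite parity.
\<close>
lemma theta_product:
  assumes "Im \<tau> > 0"
  shows "theta \<tau> (x + y) * theta \<tau> (x - y)
           = theta_even \<tau> x * theta_odd \<tau> y - theta_odd \<tau> x * theta_even \<tau> y"
proof -
  define c where "c = of_real pi * \<i> * \<tau> / 2"
  define t where "t m z = exp (c * of_int m ^ 2 + of_real pi * \<i> * of_int m * (2 * z))" for m :: int and z
  define s where "s m z = exp (c / 2 * of_int m ^ 2 + of_real pi * \<i> * of_int m * (z + 1/2))" for m :: int and z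
  have c: "Re c < 0" "Re (c / 2) < 0" using assms by (auto simp: c_def)
  have abs_t: "(\<lambda>m. norm (t m z)) summable_on M" for z M
    unfolding t_def by (rule gauss_abs_summable[OF c(1)])
  have abs_s: "(\<lambda>m. norm (s m z)) summable_on M" for z M
    unfolding s_def by (rule gauss_abs_summable[OF c(2)])
  define E O' where "E = {m::int. even m}" and "O' = {m::int. odd m}"
  have th: "theta \<tau> z = infsum (\<lambda>m. s m z) O'" for z
    by (simp add: theta_eq_gauss_series gauss_series_def s_def c_def O'_def)
  have ev: "theta_even \<tau> z = infsum (\<lambda>m. t m z) E" for z
    by (simp add: theta_even_def gauss_series_def t_def c_def E_def)
  have od: "theta_odd \<tau> z = infsum (\<lambda>m. t m z) O'" for z
    by (simp add: theta_odd_def gauss_series_def t_def c_def O'_def)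
  have lhs: "((\<lambda>(j, k). s j (x + y) * s k (x - y)) has_sum (theta \<tau> (x + y) * theta \<tau> (x - y))) (O' \<times> O')"
    unfolding th by (rule has_sum_product[OF abs_s abs_s])
  \<comment> \<open>The identity (j^2 + k^2) / 2 = m^2 + n^2 turns the coefficient c / 2 into c. The
    two offsets 1/2 contribute exp(pi \<i> m), the sign that makes the product a
    determinant.\<close>
  have st: "s j (x + y) * s k (x - y) = (if even m then 1 else - 1) * (t m x * t n y)"
    if "j = m + n" "k = m - n" for j k m n
  proof -
    have "s j (x + y) * s k (x - y) = exp (of_real pi * \<i> * of_int m) * (t m x * t n y)"
      unfolding s_def t_def exp_add[symmetric] that
      by (rule arg_cong[of _ _ exp]) (simp add: field_simps power2_eq_square)
    then show ?thesis by (simp add: exp_odd_pi_i exp_even_pi_i)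
  qed
  have "((\<lambda>(m, n). (if even m then 1 else - 1) * (t m x * t n y)) has_sum
           (theta \<tau> (x + y) * theta \<tau> (x - y))) (E \<times> O' \<union> O' \<times> E)"
  proof -
    \<comment> \<open>Half-sum and half-difference of two odd integers add up to an odd integer, so
      exactly one of them is even.\<close>
    have "bij_betw (\<lambda>(m, n). (m + n, m - n)) (E \<times> O' \<union> O' \<times> E) (O' \<times> O')"
    proof (rule bij_betw_byWitness[of _ "\<lambda>(j, k). ((j + k) div 2, (j - k) div 2)"])
      have "((j + k) div 2, (j - k) div 2) \<in> E \<times> O' \<union> O' \<times> E" "(j + k) div 2 + (j - k) div 2 = j"
        "(j + k) div 2 - (j - k) div 2 = k" if odd: "odd j" "odd k" for j k
      proof -
        obtain a b where ab: "j = 2 * a + 1" "k = 2 * b + 1"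
          using odd by (elim oddE)
        have "j + k = 2 * (a + b + 1)" "j - k = 2 * (a - b)" using ab by simp_all
        then have d: "(j + k) div 2 = a + b + 1" "(j - k) div 2 = a - b" by simp_all
        show "((j + k) div 2, (j - k) div 2) \<in> E \<times> O' \<union> O' \<times> E" "(j + k) div 2 + (j - k) div 2 = j"
        "(j + k) div 2 - (j - k) div 2 = k" unfolding d by (auto simp: ab E_def O'_def)
      qed
      then show "\<forall>p\<in>O' \<times> O'. (\<lambda>(m, n). (m + n, m - n)) ((\<lambda>(j, k). ((j + k) div 2, (j - k) div 2)) p) = p"
        and "(\<lambda>(j, k). ((j + k) div 2, (j - k) div 2)) ` (O' \<times> O') \<subseteq> E \<times> O' \<union> O' \<times> E"
        by (auto simp: O'_def)
    qed (auto simp: E_def O'_def)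
    from has_sum_reindex_bij_betw[OF this, THEN iffD2, OF lhs] show ?thesis
      by (simp add: case_prod_unfold st[OF refl refl])
  qed
  moreover have "((\<lambda>(m, n). (if even m then 1 else - 1) * (t m x * t n y)) has_sum
           (theta_even \<tau> x * theta_odd \<tau> y + - (theta_odd \<tau> x * theta_even \<tau> y))) (E \<times> O' \<union> O' \<times> E)"
  proof (rule has_sum_Un_disjoint)
    have "((\<lambda>(m, n). t m x * t n y) has_sum theta_even \<tau> x * theta_odd \<tau> y) (E \<times> O')"
      unfolding ev od by (rule has_sum_product[OF abs_t abs_t])
    then show "((\<lambda>(m, n). (if even m then 1 else - 1) * (t m x * t n y)) has_sum theta_even \<tau> x * theta_odd \<tau> y) (E \<times> O')"
      by (rule has_sum_cong[THEN iffD1, rotated]) (auto simp: E_def)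
    have "((\<lambda>(m, n). t m x * t n y) has_sum theta_odd \<tau> x * theta_even \<tau> y) (O' \<times> E)"
      unfolding ev od by (rule has_sum_product[OF abs_t abs_t])
    then have "((\<lambda>p. - (case p of (m, n) \<Rightarrow> t m x * t n y)) has_sum - (theta_odd \<tau> x * theta_even \<tau> y)) (O' \<times> E)"
      by (rule has_sum_uminusI)
    then show "((\<lambda>(m, n). (if even m then 1 else - 1) * (t m x * t n y)) has_sum - (theta_odd \<tau> x * theta_even \<tau> y)) (O' \<times> E)"
      by (rule has_sum_cong[THEN iffD1, rotated]) (auto simp: O'_def)
  qed (auto simp: E_def O'_def)
  ultimately have "theta \<tau> (x + y) * theta \<tau> (x - y)
      = theta_even \<tau> x * theta_odd \<tau> y + - (theta_odd \<tau> x * theta_even \<tau> y)"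
    by (rule has_sum_unique)
  then show ?thesis by simp
qed

lemma theta_three_term:
  assumes "Im \<tau> > 0"
  shows "theta \<tau> (x + y) * theta \<tau> (x - y) * (theta \<tau> (u + v) * theta \<tau> (u - v))
       - theta \<tau> (x + u) * theta \<tau> (x - u) * (theta \<tau> (y + v) * theta \<tau> (y - v))
       + theta \<tau> (x + v) * theta \<tau> (x - v) * (theta \<tau> (y + u) * theta \<tau> (y - u)) = 0"
  unfolding theta_product[OF assms] by (simp add: algebra_simps)

section \<open>Half-periods and elliptic functions\<close>

lemma entire_zeros_countable:
  assumes "f holomorphic_on UNIV" and "\<exists>z. f z \<noteq> 0"
  shows "countable {z. f z = 0}"
proof (cases "f constant_on UNIV")
  case True
  then have "{z. f z = 0} = {}" using assms(2) by (auto simp: constant_on_def)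
  then show ?thesis by simp
next
  case False
  then show ?thesis using holomorphic_countable_zeros[OF assms(1)] by auto
qed

text \<open>Finitely many countable zero sets cannot cover the plane. This supplies both the absence
  of zero divisors among entire functions and the existence of points off the poles.\<close>

lemma entire_common_nonzero:
  fixes f :: "'a \<Rightarrow> complex \<Rightarrow> complex"
  assumes "finite I" and "\<And>i. i \<in> I \<Longrightarrow> f i holomorphic_on UNIV" and "\<And>i. i \<in> I \<Longrightarrow> \<exists>z. f i z \<noteq> 0"
  shows "\<exists>z. \<forall>i\<in>I. f i z \<noteq> 0"
proof -
  have "countable (\<Union>i\<in>I. {z. f i z = 0})"
    using assms by (intro countable_UN countable_finite entire_zeros_countable) auto
  then have "(\<Union>i\<in>I. {z. f i z = 0}) \<noteq> UNIV"
    using uncountable_UNIV_complex by metis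
  then show ?thesis by blast
qed

lemma entire_product_zero:
  assumes "f holomorphic_on UNIV" "g holomorphic_on UNIV" and "\<And>z. f z * g z = 0"
  shows "(\<forall>z. f z = 0) \<or> (\<forall>z. g z = 0)"
proof (rule ccontr)
  assume "\<not> ?thesis"
  then have "\<exists>z. \<forall>i\<in>(UNIV :: bool set). (if i then f else g) z \<noteq> 0"
    using assms(1,2) by (intro entire_common_nonzero) auto
  then show False using assms(3) by (auto simp: all_bool_eq)
qed

text \<open>Near a point where f does not vanish the quotient g / f has derivative 0, so g = k f on
  a ball. A ball is uncountable, so g - k f vanishes identically, and proportional functions satisfy
  the claim. If f = 0 everywhere, both sides are 0.\<close>

lemma wronskian_zero:
  assumes f: "f holomorphic_on UNIV" and g: "g holomorphic_on UNIV"
    and W: "\<And>z. f z * deriv g z = g z * deriv f z"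
  shows "f x * g y = g x * f y"
proof (cases "\<exists>a. f a \<noteq> 0")
  case True
  then obtain a where a: "f a \<noteq> 0" by blast
  have "isCont f a" using f
    by (meson UNIV_I continuous_on_eq_continuous_at holomorphic_on_imp_continuous_on open_UNIV)
  then obtain r where "r > 0" "\<forall>z. dist a z < r \<longrightarrow> f z \<noteq> 0"
    using continuous_at_avoid[of a f 0] a by blast
  then have r: "r > 0" "\<And>z. z \<in> ball a r \<Longrightarrow> f z \<noteq> 0" by simp_all
  have "((\<lambda>z. g z / f z) has_field_derivative 0) (at z within ball a r)" if "z \<in> ball a r" for z
  proof -
    have f': "(f has_field_derivative deriv f z) (at z)" and g': "(g has_field_derivative deriv g z) (at z)"
      using f g by (auto intro: holomorphic_derivI)
    have "((\<lambda>z. g z / f z) has_field_derivative (deriv g z * f z - g z * deriv f z) / (f z * f z)) (at z)"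
      by (rule DERIV_divide[OF g' f' r(2)[OF that]])
    moreover have "deriv g z * f z - g z * deriv f z = 0" using W[of z] by (simp add: mult.commute)
    ultimately have "((\<lambda>z. g z / f z) has_field_derivative 0) (at z)" by simp
    then show ?thesis by (rule has_field_derivative_at_within)
  qed
  then have "\<exists>k. \<forall>z\<in>ball a r. g z / f z = k"
    by (intro has_field_derivative_zero_constant[OF convex_ball]) auto
  then obtain k where k: "\<And>z. z \<in> ball a r \<Longrightarrow> g z / f z = k" by blast
  have zero: "g z - k * f z = 0" for z
  proof (rule ccontr)
    assume "g z - k * f z \<noteq> 0"
    then have "countable {z. g z - k * f z = 0}"
      using f g by (intro entire_zeros_countable) (auto intro!: holomorphic_intros)
    moreover have "ball a r \<subseteq> {z. g z - k * f z = 0}"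
      using k r(2) by (auto simp: field_simps)
    ultimately show False using countable_subset uncountable_ball[OF r(1)] by blast
  qed
  then have "g z = k * f z" for z using zero[of z] by simp
  then show ?thesis by simp
qed auto

context
  fixes \<tau> :: complex
  assumes tau: "Im \<tau> > 0"
begin

lemma theta_DERIV: "(theta \<tau> has_field_derivative deriv (theta \<tau>) z) (at z)"
  using theta_holomorphic[OF tau] by (auto intro: holomorphic_derivI)

lemma theta_deriv_DERIV: "(deriv (theta \<tau>) has_field_derivative deriv (deriv (theta \<tau>)) z) (at z)"
  using theta_holomorphic[OF tau] by (auto intro!: holomorphic_derivI holomorphic_deriv)

lemmas theta_derivative_intros =
  DERIV_chain2[OF theta_DERIV] DERIV_chain2[OF theta_deriv_DERIV]

lemma theta_even_holomorphic: "theta_even \<tau> holomorphic_on UNIV"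
  and theta_odd_holomorphic: "theta_odd \<tau> holomorphic_on UNIV"
proof -
  have "(gauss_series M (of_real pi * \<i> * \<tau> / 2) \<circ> (\<lambda>x. 2 * x)) holomorphic_on UNIV" for M
    by (rule holomorphic_on_compose_gen[OF _ gauss_series_holomorphic[OF Re_theta_coeff2[OF tau]]])
       (auto intro!: holomorphic_intros)
  then show "theta_even \<tau> holomorphic_on UNIV" "theta_odd \<tau> holomorphic_on UNIV"
    by (simp_all add: o_def theta_even_def[abs_def] theta_odd_def[abs_def])
qed

lemma theta_even_not_zero: "\<exists>x. theta_even \<tau> x \<noteq> 0"
  and theta_odd_not_zero: "\<exists>x. theta_odd \<tau> x \<noteq> 0"
proof -
  have *: "\<exists>x. gauss_series M (of_real pi * \<i> * \<tau> / 2) (2 * x) \<noteq> 0" if k: "k \<in> M" for k M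
  proof -
    obtain u where "gauss_series M (of_real pi * \<i> * \<tau> / 2) u \<noteq> 0"
      using gauss_series_not_identically_zero[OF Re_theta_coeff2[OF tau] k] by blast
    then have "gauss_series M (of_real pi * \<i> * \<tau> / 2) (2 * (u / 2)) \<noteq> 0" by simp
    then show ?thesis by blast
  qed
  show "\<exists>x. theta_even \<tau> x \<noteq> 0" "\<exists>x. theta_odd \<tau> x \<noteq> 0"
    unfolding theta_even_def theta_odd_def using *[of 0] *[of 1] by auto
qed

text \<open>At y = 0 in the product formula, proportionality would force theta(u)^2 = 0 for every
  u.\<close>

lemma theta_even_odd_independent: "\<not> (\<forall>x y. theta_even \<tau> x * theta_odd \<tau> y = theta_odd \<tau> x * theta_even \<tau> y)"
proof
  assume *: "\<forall>x y. theta_even \<tau> x * theta_odd \<tau> y = theta_odd \<tau> x * theta_even \<tau> y"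
  obtain u where u: "theta \<tau> u \<noteq> 0" using theta_not_identically_zero[OF tau] by blast
  have "theta \<tau> u * theta \<tau> u = 0" using theta_product[OF tau, of u 0] * by simp
  with u show False by simp
qed

lemma deriv_theta_0_nonzero: "deriv (theta \<tau>) 0 \<noteq> 0"
proof
  assume 0: "deriv (theta \<tau>) 0 = 0"
  have "theta_even \<tau> x * deriv (theta_odd \<tau>) x = theta_odd \<tau> x * deriv (theta_even \<tau>) x" for x
  proof -
    \<comment> \<open>At y = x the factor theta(x - y) vanishes, so the derivative there is -
      theta(2 x) theta'(0).\<close>
    have 1: "((\<lambda>y. theta \<tau> (x + y) * theta \<tau> (x - y)) has_field_derivative 0) (at x)"
      by (auto intro!: derivative_eq_intros theta_derivative_intros simp: 0)
    have "(theta_even \<tau> has_field_derivative deriv (theta_even \<tau>) x) (at x)"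
      "(theta_odd \<tau> has_field_derivative deriv (theta_odd \<tau>) x) (at x)"
      using theta_even_holomorphic theta_odd_holomorphic by (auto intro: holomorphic_derivI)
    then have "((\<lambda>y. theta_even \<tau> x * theta_odd \<tau> y - theta_odd \<tau> x * theta_even \<tau> y) has_field_derivative
        theta_even \<tau> x * deriv (theta_odd \<tau>) x - theta_odd \<tau> x * deriv (theta_even \<tau>) x) (at x)"
      by (auto intro!: derivative_eq_intros)
    with 1 show ?thesis unfolding theta_product[OF tau] using DERIV_unique by fastforce
  qed
  then show False
    using wronskian_zero[OF theta_even_holomorphic theta_odd_holomorphic] theta_even_odd_independent
    by blast
qed

text \<open>A difference of two squares factors; one factor would vanish identically and make the
  two series proportional. Needed with k = 1 and k = \<i>, for the half-periods \<tau>/2 and (1 +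
  \<tau>)/2.\<close>

lemma theta_even_odd_squares: "\<exists>x. (theta_even \<tau> x)\<^sup>2 \<noteq> (k * theta_odd \<tau> x)\<^sup>2"
proof (rule ccontr)
  assume "\<not> ?thesis"
  then have "(theta_even \<tau> x - k * theta_odd \<tau> x) * (theta_even \<tau> x + k * theta_odd \<tau> x) = 0" for x
    by (simp add: algebra_simps power2_eq_square)
  then have "(\<forall>x. theta_even \<tau> x - k * theta_odd \<tau> x = 0) \<or> (\<forall>x. theta_even \<tau> x + k * theta_odd \<tau> x = 0)"
    by (intro entire_product_zero)
       (auto intro!: holomorphic_intros theta_even_holomorphic theta_odd_holomorphic)
  then have "(\<forall>x. theta_even \<tau> x = k * theta_odd \<tau> x) \<or> (\<forall>x. theta_even \<tau> x = (- k) * theta_odd \<tau> x)"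
    by (simp add: eq_neg_iff_add_eq_0)
  then show False using theta_even_odd_independent by (auto simp: mult_ac)
qed

lemma theta_half_period_nonzero:
  "theta \<tau> (1/2) \<noteq> 0" "theta \<tau> (\<tau>/2) \<noteq> 0" "theta \<tau> ((1 + \<tau>)/2) \<noteq> 0"
proof -
  define e where "e x = exp (- (of_real pi * \<i> * \<tau> / 2) * of_int 1 ^ 2 - of_real pi * \<i> * of_int 1 * (2 * x))" for x
  have ev1: "theta_even \<tau> (x + 1/2) = theta_even \<tau> x" for x
  proof -
    have "theta_even \<tau> (x + 1/2) = gauss_series {m. even m} (of_real pi * \<i> * \<tau> / 2) (2 * x + 1)"
      by (simp add: theta_even_def algebra_simps)
    also have "\<dots> = 1 * theta_even \<tau> x"
      unfolding theta_even_def by (rule gauss_series_shift_multiplier) (simp add: exp_even_pi_i)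
    finally show ?thesis by simp
  qed
  have od1: "theta_odd \<tau> (x + 1/2) = - theta_odd \<tau> x" for x
  proof -
    have "theta_odd \<tau> (x + 1/2) = gauss_series {m. odd m} (of_real pi * \<i> * \<tau> / 2) (2 * x + 1)"
      by (simp add: theta_odd_def algebra_simps)
    also have "\<dots> = - 1 * theta_odd \<tau> x"
      unfolding theta_odd_def by (rule gauss_series_shift_multiplier) (simp add: exp_odd_pi_i)
    finally show ?thesis by simp
  qed
  have ev2: "theta_even \<tau> (x + \<tau>/2) = e x * theta_odd \<tau> x" for x
  proof -
    have "theta_even \<tau> (x + \<tau>/2) = gauss_series {m. even m} (of_real pi * \<i> * \<tau> / 2) (2 * x + \<tau>)"
      by (simp add: theta_even_def algebra_simps)
    also have "\<dots> = e x * theta_odd \<tau> x"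
      unfolding theta_odd_def e_def by (rule gauss_series_shift_coeff) (auto intro: bij_betw_add_int)
    finally show ?thesis .
  qed
  have od2: "theta_odd \<tau> (x + \<tau>/2) = e x * theta_even \<tau> x" for x
  proof -
    have "theta_odd \<tau> (x + \<tau>/2) = gauss_series {m. odd m} (of_real pi * \<i> * \<tau> / 2) (2 * x + \<tau>)"
      by (simp add: theta_odd_def algebra_simps)
    also have "\<dots> = e x * theta_even \<tau> x"
      unfolding theta_even_def e_def by (rule gauss_series_shift_coeff) (auto intro: bij_betw_add_int)
    finally show ?thesis .
  qed
  have e: "e x \<noteq> 0" for x by (simp add: e_def)
  \<comment> \<open>With arguments x + t and x the factor theta(t) stays fixed while x varies, so a
    zero at t makes the determinant vanish identically. The shift rules express that determinant
    through values at x alone.\<close>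
  have prod: "theta \<tau> (2 * x + t) * theta \<tau> t
      = theta_even \<tau> (x + t) * theta_odd \<tau> x - theta_odd \<tau> (x + t) * theta_even \<tau> x" for x t
    using theta_product[OF tau, of "x + t" x] by (simp add: algebra_simps)
  show "theta \<tau> (1/2) \<noteq> 0"
  proof
    assume "theta \<tau> (1/2) = 0"
    then have "theta_even \<tau> x * theta_odd \<tau> x = 0" for x
      using prod[of x "1/2"] by (simp add: ev1 od1 mult.commute del: mult_eq_0_iff)
    then show False
      using entire_product_zero[OF theta_even_holomorphic theta_odd_holomorphic]
        theta_even_not_zero theta_odd_not_zero by blast
  qed
  show "theta \<tau> (\<tau>/2) \<noteq> 0"
  proof
    assume "theta \<tau> (\<tau>/2) = 0"
    then have "e x * ((theta_odd \<tau> x)\<^sup>2 - (theta_even \<tau> x)\<^sup>2) = 0" for x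
      using prod[of x "\<tau>/2"] unfolding ev2 od2
      by (simp add: right_diff_distrib power2_eq_square mult.assoc del: mult_eq_0_iff)
    then have "(theta_odd \<tau> x)\<^sup>2 - (theta_even \<tau> x)\<^sup>2 = 0" for x using e[of x] mult_eq_0_iff by blast
    then have "(theta_even \<tau> x)\<^sup>2 = (1 * theta_odd \<tau> x)\<^sup>2" for x by simp
    then show False using theta_even_odd_squares by blast
  qed
  show "theta \<tau> ((1 + \<tau>)/2) \<noteq> 0"
  proof
    assume z: "theta \<tau> ((1 + \<tau>)/2) = 0"
    have *: "x + (1 + \<tau>)/2 = (x + \<tau>/2) + 1/2" for x by (simp add: field_simps)
    have "e x * ((theta_odd \<tau> x)\<^sup>2 + (theta_even \<tau> x)\<^sup>2) = 0" for x
      using prod[of x "(1 + \<tau>)/2"] z unfolding * ev1 od1 ev2 od2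
      by (simp add: distrib_left power2_eq_square mult.assoc del: mult_eq_0_iff)
    then have "(theta_odd \<tau> x)\<^sup>2 + (theta_even \<tau> x)\<^sup>2 = 0" for x using e[of x] mult_eq_0_iff by blast
    then have "(theta_even \<tau> x)\<^sup>2 = (\<i> * theta_odd \<tau> x)\<^sup>2" for x
      by (simp add: power_mult_distrib eq_neg_iff_add_eq_0 add.commute)
    then show False using theta_even_odd_squares by blast
  qed
qed

lemma theta_omega_nonzero: "\<alpha> \<in> {1, 2, 3} \<Longrightarrow> theta \<tau> (omega \<tau> \<alpha>) \<noteq> 0"
  using theta_half_period_nonzero by (auto simp: omega_def)

section \<open>The function \<open>E2\<close>; squares, translates and addition of the functions
  \<open>varphi\<close>\<close>

lemma E2_eq:
  assumes "theta \<tau> z \<noteq> 0"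
  shows "E2 \<tau> z = ((deriv (theta \<tau>) z)\<^sup>2 - deriv (deriv (theta \<tau>)) z * theta \<tau> z) / (theta \<tau> z)\<^sup>2"
proof -
  have "((\<lambda>x. deriv (theta \<tau>) x / theta \<tau> x) has_field_derivative
      (deriv (deriv (theta \<tau>)) z * theta \<tau> z - deriv (theta \<tau>) z * deriv (theta \<tau>) z) / (theta \<tau> z * theta \<tau> z)) (at z)"
    by (rule DERIV_divide[OF theta_deriv_DERIV theta_DERIV assms])
  then have "deriv (\<lambda>x. deriv (theta \<tau>) x / theta \<tau> x) z =
      (deriv (deriv (theta \<tau>)) z * theta \<tau> z - deriv (theta \<tau>) z * deriv (theta \<tau>) z) / (theta \<tau> z * theta \<tau> z)"
    by (rule DERIV_imp_deriv)
  then show ?thesis by (simp add: E2_def power2_eq_square minus_divide_left)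
qed

text \<open>
  Both sides are second derivatives at \<open>w = 0\<close> in the three-term relation for \<open>x, y, w, 0\<close>.
\<close>
lemma E2_diff:
  assumes "theta \<tau> x \<noteq> 0" "theta \<tau> y \<noteq> 0"
  shows "E2 \<tau> x - E2 \<tau> y
      = - (deriv (theta \<tau>) 0)\<^sup>2 * theta \<tau> (x + y) * theta \<tau> (x - y) / ((theta \<tau> x)\<^sup>2 * (theta \<tau> y)\<^sup>2)"
proof -
  define C where "C = theta \<tau> (x + y) * theta \<tau> (x - y)"
  define T where "T = theta \<tau>"
  define F where "F w = C * (T w)\<^sup>2 - T (x + w) * T (x - w) * (T y)\<^sup>2 + (T x)\<^sup>2 * (T (y + w) * T (y - w))" for w
  define F' where "F' w = C * (2 * T w * deriv T w)
     - (deriv T (x + w) * T (x - w) - T (x + w) * deriv T (x - w)) * (T y)\<^sup>2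
     + (T x)\<^sup>2 * (deriv T (y + w) * T (y - w) - T (y + w) * deriv T (y - w))" for w
  \<comment> \<open>This removes \<open>deriv (deriv T) 0\<close> from the second derivative of
    \<open>(T w)\<^sup>2\<close> at 0 and leaves only the square of theta'(0).\<close>
  have T0: "T 0 = 0" by (simp add: T_def)
  have "F w = 0" for w
    using theta_three_term[OF tau, of x y w 0] by (simp add: F_def C_def T_def power2_eq_square)
  then have F: "F = (\<lambda>w. 0)" by auto
  have "(F has_field_derivative F' w) (at w)" for w
    unfolding F_def[abs_def] F'_def T_def
    by (auto intro!: derivative_eq_intros theta_derivative_intros simp: algebra_simps)
  then have "F' w = 0" for w unfolding F by (metis DERIV_const DERIV_unique)
  then have F': "F' = (\<lambda>w. 0)" by auto
  have "(F' has_field_derivative (C * (2 * (deriv T 0)\<^sup>2)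
     - 2 * (deriv (deriv T) x * T x - (deriv T x)\<^sup>2) * (T y)\<^sup>2
     + (T x)\<^sup>2 * (2 * (deriv (deriv T) y * T y - (deriv T y)\<^sup>2)))) (at 0)"
    unfolding F'_def[abs_def]
    by (auto intro!: derivative_eq_intros theta_derivative_intros[folded T_def] simp: T0 algebra_simps power2_eq_square)
  then have "C * (2 * (deriv T 0)\<^sup>2)
     - 2 * (deriv (deriv T) x * T x - (deriv T x)\<^sup>2) * (T y)\<^sup>2
     + (T x)\<^sup>2 * (2 * (deriv (deriv T) y * T y - (deriv T y)\<^sup>2)) = 0"
    unfolding F' by (metis DERIV_const DERIV_unique)
  then have *: "((deriv T x)\<^sup>2 - deriv (deriv T) x * T x) * (T y)\<^sup>2
      - ((deriv T y)\<^sup>2 - deriv (deriv T) y * T y) * (T x)\<^sup>2 = - (deriv T 0)\<^sup>2 * C"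
    by algebra
  have "E2 \<tau> x - E2 \<tau> y = (((deriv T x)\<^sup>2 - deriv (deriv T) x * T x) * (T y)\<^sup>2
      - ((deriv T y)\<^sup>2 - deriv (deriv T) y * T y) * (T x)\<^sup>2) / ((T x)\<^sup>2 * (T y)\<^sup>2)"
    unfolding E2_eq[OF assms(1)] E2_eq[OF assms(2)] T_def[symmetric]
    using assms by (simp add: T_def[symmetric] diff_frac_eq)
  then show ?thesis unfolding * by (simp add: C_def T_def mult.assoc)
qed

text \<open>\<open>E2_diff\<close> for the pair - z, z contains the factor theta(- z + z) = theta(0)
  = 0.\<close>

lemma E2_minus: "theta \<tau> z \<noteq> 0 \<Longrightarrow> E2 \<tau> (- z) = E2 \<tau> z"
  using E2_diff[of "- z" z] by (simp add: theta_minus)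

lemma d_omega_eq: "\<alpha> \<in> {1, 2, 3} \<Longrightarrow> d_omega \<tau> \<alpha> = (if \<alpha> = 1 then 0 else 1/2)"
proof -
  have "((\<lambda>t. t / 2) has_field_derivative 1/2) (at \<tau>)" "((\<lambda>t. (1 + t) / 2) has_field_derivative 1/2) (at \<tau>)"
    by (auto intro!: derivative_eq_intros)
  then have "deriv (\<lambda>t. t / 2) \<tau> = 1/2" "deriv (\<lambda>t. (1 + t) / 2) \<tau> = 1/2"
    by (auto intro: DERIV_imp_deriv)
  then show "\<alpha> \<in> {1, 2, 3} \<Longrightarrow> d_omega \<tau> \<alpha> = (if \<alpha> = 1 then 0 else 1/2)"
    by (auto simp: d_omega_def omega_def)
qed

text \<open>The points z + omega_\<alpha> and z - omega_\<alpha> differ by the period 1, \<tau> or 1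
  + \<tau>. Writing the multiplier through \<open>d_omega\<close> covers the three cases by one
  formula with the same sign.\<close>

lemma theta_omega_shift:
  assumes "\<alpha> \<in> {1, 2, 3}"
  shows "theta \<tau> (z + omega \<tau> \<alpha>)
           = - exp (- (4 * of_real pi * \<i> * z * d_omega \<tau> \<alpha>)) * theta \<tau> (z - omega \<tau> \<alpha>)"
proof -
  consider "\<alpha> = 1" | "\<alpha> = 2" | "\<alpha> = 3" using assms by auto
  then show ?thesis
  proof cases
    case 1
    then show ?thesis using theta_add_one[of \<tau> "z - 1/2"] by (simp add: d_omega_eq omega_def add.commute)
  next
    case 2
    have "theta \<tau> (z + omega \<tau> \<alpha>) = theta \<tau> ((z - omega \<tau> \<alpha>) + \<tau>)"
      by (rule arg_cong[of _ _ "theta \<tau>"]) (simp add: 2 omega_def)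
    also have "\<dots> = - exp (- of_real pi * \<i> * \<tau> - 2 * of_real pi * \<i> * (z - omega \<tau> \<alpha>)) * theta \<tau> (z - omega \<tau> \<alpha>)"
      by (rule theta_add_tau)
    also have "- of_real pi * \<i> * \<tau> - 2 * of_real pi * \<i> * (z - omega \<tau> \<alpha>) = - (4 * of_real pi * \<i> * z * d_omega \<tau> \<alpha>)"
      using 2 by (simp add: d_omega_eq omega_def algebra_simps)
    finally show ?thesis .
  next
    case 3
    have "theta \<tau> (z + omega \<tau> \<alpha>) = theta \<tau> (((z - omega \<tau> \<alpha>) + 1) + \<tau>)"
      by (rule arg_cong[of _ _ "theta \<tau>"]) (simp add: 3 omega_def field_simps)
    also have "\<dots> = exp (- of_real pi * \<i> * \<tau> - 2 * of_real pi * \<i> * (z - omega \<tau> \<alpha> + 1)) * theta \<tau> (z - omega \<tau> \<alpha>)"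
      by (simp add: theta_add_tau theta_add_one)
    \<comment> \<open>The signs from the two periods cancel; the exponent keeps a summand - pi \<i>,
      which restores the common sign.\<close>
    also have "- of_real pi * \<i> * \<tau> - 2 * of_real pi * \<i> * (z - omega \<tau> \<alpha> + 1)
        = - (4 * of_real pi * \<i> * z * d_omega \<tau> \<alpha>) + - (of_real pi * \<i>)"
      using 3 by (simp add: d_omega_eq omega_def algebra_simps)
    finally show ?thesis unfolding exp_add by (simp add: exp_minus)
  qed
qed

lemma varphi_eq:
  "varphi \<tau> \<alpha> z = exp (2 * of_real pi * \<i> * z * d_omega \<tau> \<alpha>) * theta \<tau> (z + omega \<tau> \<alpha>)
     * deriv (theta \<tau>) 0 / (theta \<tau> z * theta \<tau> (omega \<tau> \<alpha>))"
  by (simp add: varphi_def phi_def)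

text \<open>The square of the exponential prefactor of \<open>varphi\<close> is inverse, up to sign,
  to the multiplier in \<open>theta_omega_shift\<close>. Hence the numerator of
  \<open>varphi\<close> is even in z, and the sign comes from theta(- z) in the denominator.\<close>

lemma varphi_minus:
  assumes "\<alpha> \<in> {1, 2, 3}"
  shows "varphi \<tau> \<alpha> (- z) = - varphi \<tau> \<alpha> z"
proof -
  have "theta \<tau> (- z + omega \<tau> \<alpha>) = exp (4 * of_real pi * \<i> * z * d_omega \<tau> \<alpha>) * theta \<tau> (z + omega \<tau> \<alpha>)"
    using theta_omega_shift[OF assms, of "- z"] theta_minus[of \<tau> "z + omega \<tau> \<alpha>"] by simp
  moreover have "exp (2 * of_real pi * \<i> * (- z) * d_omega \<tau> \<alpha>) * exp (4 * of_real pi * \<i> * z * d_omega \<tau> \<alpha>)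
      = exp (2 * of_real pi * \<i> * z * d_omega \<tau> \<alpha>)"
    unfolding exp_add[symmetric] by (rule arg_cong[of _ _ exp]) simp
  ultimately show ?thesis
    unfolding varphi_eq theta_minus[of \<tau> z] by (simp add: mult.assoc[symmetric])
qed

lemma varphi_nonzero:
  assumes "\<alpha> \<in> {1, 2, 3}" "theta \<tau> z \<noteq> 0" "theta \<tau> (z - omega \<tau> \<alpha>) \<noteq> 0"
  shows "varphi \<tau> \<alpha> z \<noteq> 0"
  unfolding varphi_eq theta_omega_shift[OF assms(1)]
  using assms theta_omega_nonzero deriv_theta_0_nonzero by simp

text \<open>One of the two factors theta(z + omega_\<alpha>) is moved to theta(z - omega_\<alpha>),
  which cancels the exponentials; the resulting product of theta values is the one that
  \<open>E2_diff\<close> evaluates.\<close>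

lemma varphi_square:
  assumes a: "\<alpha> \<in> {1, 2, 3}" and z: "theta \<tau> z \<noteq> 0"
  shows "(varphi \<tau> \<alpha> z)\<^sup>2 = E2 \<tau> z - E2 \<tau> (omega \<tau> \<alpha>)"
proof -
  have *: "(exp (2 * of_real pi * \<i> * z * d_omega \<tau> \<alpha>))\<^sup>2 * exp (- (4 * of_real pi * \<i> * z * d_omega \<tau> \<alpha>)) = 1"
    by (simp add: power2_eq_square exp_add[symmetric])
  have "(varphi \<tau> \<alpha> z)\<^sup>2 = (exp (2 * of_real pi * \<i> * z * d_omega \<tau> \<alpha>))\<^sup>2 * (theta \<tau> (z + omega \<tau> \<alpha>) * theta \<tau> (z + omega \<tau> \<alpha>))
      * (deriv (theta \<tau>) 0)\<^sup>2 / ((theta \<tau> z)\<^sup>2 * (theta \<tau> (omega \<tau> \<alpha>))\<^sup>2)"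
    unfolding varphi_eq by (simp add: power2_eq_square mult_ac)
  also have "(exp (2 * of_real pi * \<i> * z * d_omega \<tau> \<alpha>))\<^sup>2 * (theta \<tau> (z + omega \<tau> \<alpha>) * theta \<tau> (z + omega \<tau> \<alpha>))
     = - ((exp (2 * of_real pi * \<i> * z * d_omega \<tau> \<alpha>))\<^sup>2 * exp (- (4 * of_real pi * \<i> * z * d_omega \<tau> \<alpha>)))
         * (theta \<tau> (z + omega \<tau> \<alpha>) * theta \<tau> (z - omega \<tau> \<alpha>))"
    by (subst (2) theta_omega_shift[OF a]) simp
  finally show ?thesis
    unfolding E2_diff[OF z theta_omega_nonzero[OF a]] * by simp
qed

text \<open>The product of \<open>varphi\<close> at z and at z - omega_\<alpha> does not depend on
  z, since all theta factors in z cancel. Its value times \<nu> is \<open>nu'\<close>, which is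
  where that constant originates. The inhomogeneous part of the Lax matrix is thereby freed of
  shifted arguments.\<close>

lemma varphi_shift:
  assumes a: "\<alpha> \<in> {1, 2, 3}" and z: "theta \<tau> z \<noteq> 0" "theta \<tau> (z - omega \<tau> \<alpha>) \<noteq> 0"
  shows "\<nu> \<alpha> * varphi \<tau> \<alpha> (z - omega \<tau> \<alpha>) = nu' \<tau> \<nu> \<alpha> / varphi \<tau> \<alpha> z"
proof -
  define o' d T where "o' = omega \<tau> \<alpha>" and "d = d_omega \<tau> \<alpha>" and "T = deriv (theta \<tau>) 0"
  have nz: "theta \<tau> o' \<noteq> 0" "T \<noteq> 0"
    using theta_omega_nonzero[OF a] deriv_theta_0_nonzero by (simp_all add: o'_def T_def)
  have "varphi \<tau> \<alpha> (z - o') * varphi \<tau> \<alpha> z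
     = exp (2 * of_real pi * \<i> * (z - o') * d) * exp (2 * of_real pi * \<i> * z * d)
        * theta \<tau> (z + o') / theta \<tau> (z - o') * (T / theta \<tau> o')\<^sup>2"
    using z nz by (simp add: varphi_eq o'_def[symmetric] d_def[symmetric] T_def[symmetric] power2_eq_square)
  also have "\<dots> = - (exp (2 * of_real pi * \<i> * (z - o') * d) * exp (2 * of_real pi * \<i> * z * d)
        * exp (- (4 * of_real pi * \<i> * z * d))) * (T / theta \<tau> o')\<^sup>2"
    using z theta_omega_shift[OF a, of z] by (simp add: o'_def[symmetric] d_def[symmetric])
  also have "exp (2 * of_real pi * \<i> * (z - o') * d) * exp (2 * of_real pi * \<i> * z * d)
        * exp (- (4 * of_real pi * \<i> * z * d)) = exp (- 2 * of_real pi * \<i> * o' * d)"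
    unfolding exp_add[symmetric] by (rule arg_cong[of _ _ exp]) (simp add: algebra_simps)
  finally have "\<nu> \<alpha> * (varphi \<tau> \<alpha> (z - o') * varphi \<tau> \<alpha> z) = nu' \<tau> \<nu> \<alpha>"
    by (simp add: nu'_def o'_def[symmetric] d_def[symmetric] T_def[symmetric])
  then show ?thesis
    using varphi_nonzero[OF a z] by (simp add: o'_def[symmetric] field_simps)
qed

text \<open>
  The three-term relation at \<open>x = u + a/2\<close>, \<open>y = v + a/2\<close> with the remaining arguments
  \<open>a/2\<close> and \<open>b - a/2\<close>.
\<close>
lemma theta_addition:
  "theta \<tau> (u + v + a) * theta \<tau> (u - v) * (theta \<tau> b * theta \<tau> (a - b))
     = theta \<tau> (u + a) * theta \<tau> u * (theta \<tau> (v + b) * theta \<tau> (v + a - b))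
     - theta \<tau> (v + a) * theta \<tau> v * (theta \<tau> (u + b) * theta \<tau> (u + a - b))"
proof -
  have s: "u + a/2 + (v + a/2) = u + v + a" "u + a/2 - (v + a/2) = u - v"
    "a/2 + (b - a/2) = b" "a/2 - (b - a/2) = a - b"
    "u + a/2 + a/2 = u + a" "u + a/2 - a/2 = u" "v + a/2 + a/2 = v + a" "v + a/2 - a/2 = v"
    "u + a/2 + (b - a/2) = u + b" "u + a/2 - (b - a/2) = u + a - b"
    "v + a/2 + (b - a/2) = v + b" "v + a/2 - (b - a/2) = v + a - b"
    by (simp_all add: field_simps)
  show ?thesis
    using theta_three_term[OF tau, of "u + a/2" "v + a/2" "a/2" "b - a/2"]
    unfolding s by (simp add: algebra_simps)
qed

text \<open>With a = omega_\<alpha> and b = omega_\<beta> in \<open>theta_addition\<close>, a - b is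
  to be the third half-period up to sign. \<open>shift\<close> records this with a factor
  \<open>s\<close> (later 1 or - 1), which occurs in every term and cancels, and an exponential that
  turns the prefactor of \<alpha> into those of \<beta> and \<gamma>. The difference of
  \<open>E2\<close> values clears the denominator theta(z + w) and supplies theta(z - w).\<close>

lemma varphi_addition_aux:
  assumes abc: "\<alpha> \<in> {1, 2, 3}" "\<beta> \<in> {1, 2, 3}" "\<gamma> \<in> {1, 2, 3}"
    and shift: "\<And>v. theta \<tau> (v + omega \<tau> \<alpha> - omega \<tau> \<beta>)
      = s * exp (2 * of_real pi * \<i> * v * (d_omega \<tau> \<beta> + d_omega \<tau> \<gamma> - d_omega \<tau> \<alpha>)) * theta \<tau> (v + omega \<tau> \<gamma>)"
    and s: "s \<noteq> 0"
    and z: "theta \<tau> z \<noteq> 0" "theta \<tau> w \<noteq> 0" "theta \<tau> (z + w) \<noteq> 0"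
  shows "varphi \<tau> \<alpha> (z + w) * (E2 \<tau> w - E2 \<tau> z)
     = varphi \<tau> \<alpha> z * varphi \<tau> \<beta> w * varphi \<tau> \<gamma> w - varphi \<tau> \<alpha> w * varphi \<tau> \<beta> z * varphi \<tau> \<gamma> z"
proof -
  define a b c where "a = omega \<tau> \<alpha>" and "b = omega \<tau> \<beta>" and "c = omega \<tau> \<gamma>"
  define da db dc where "da = d_omega \<tau> \<alpha>" and "db = d_omega \<tau> \<beta>" and "dc = d_omega \<tau> \<gamma>"
  define T where "T = deriv (theta \<tau>) 0"
  define e where "e x = exp (2 * of_real pi * \<i> * x)" for x
  have e_add: "e (x + y) = e x * e y" for x y by (simp add: e_def exp_add algebra_simps)
  have nz: "theta \<tau> a \<noteq> 0" "theta \<tau> b \<noteq> 0" "theta \<tau> c \<noteq> 0"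
    using theta_omega_nonzero abc by (auto simp: a_def b_def c_def)
  have sh: "theta \<tau> (v + a - b) = s * e (v * (db + dc - da)) * theta \<tau> (v + c)" for v
    using shift[of v] by (simp add: a_def b_def c_def da_def db_def dc_def e_def mult.assoc)
  have "theta \<tau> (a - b) = s * theta \<tau> c" using sh[of 0] by (simp add: e_def)
  then have "s * (theta \<tau> (z + w + a) * theta \<tau> (z - w) * (theta \<tau> b * theta \<tau> c))
     = s * (theta \<tau> (z + a) * theta \<tau> z * (theta \<tau> (w + b) * (e (w * (db + dc - da)) * theta \<tau> (w + c)))
     - theta \<tau> (w + a) * theta \<tau> w * (theta \<tau> (z + b) * (e (z * (db + dc - da)) * theta \<tau> (z + c))))"
    using theta_addition[of z w a b] unfolding sh by (simp add: algebra_simps)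
  then have "e ((z + w) * da) * (theta \<tau> (z + w + a) * theta \<tau> (z - w) * (theta \<tau> b * theta \<tau> c))
     = e ((z + w) * da) * (theta \<tau> (z + a) * theta \<tau> z * (theta \<tau> (w + b) * (e (w * (db + dc - da)) * theta \<tau> (w + c)))
     - theta \<tau> (w + a) * theta \<tau> w * (theta \<tau> (z + b) * (e (z * (db + dc - da)) * theta \<tau> (z + c))))"
    using s by simp
  also have "\<dots> = (e ((z + w) * da) * e (w * (db + dc - da))) * (theta \<tau> (z + a) * theta \<tau> z * theta \<tau> (w + b) * theta \<tau> (w + c))
     - (e ((z + w) * da) * e (z * (db + dc - da))) * (theta \<tau> (w + a) * theta \<tau> w * theta \<tau> (z + b) * theta \<tau> (z + c))"
    by (simp add: algebra_simps)
  also have "e ((z + w) * da) * e (w * (db + dc - da)) = e (z * da) * e (w * db) * e (w * dc)"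
    unfolding e_add[symmetric] by (rule arg_cong[of _ _ e]) (simp add: algebra_simps)
  also have "e ((z + w) * da) * e (z * (db + dc - da)) = e (w * da) * e (z * db) * e (z * dc)"
    unfolding e_add[symmetric] by (rule arg_cong[of _ _ e]) (simp add: algebra_simps)
  finally have key: "e ((z + w) * da) * (theta \<tau> (z + w + a) * theta \<tau> (z - w) * (theta \<tau> b * theta \<tau> c))
     = e (z * da) * e (w * db) * e (w * dc) * (theta \<tau> (z + a) * theta \<tau> z * theta \<tau> (w + b) * theta \<tau> (w + c))
     - e (w * da) * e (z * db) * e (z * dc) * (theta \<tau> (w + a) * theta \<tau> w * theta \<tau> (z + b) * theta \<tau> (z + c))" .
  have va: "varphi \<tau> \<alpha> x = e (x * da) * theta \<tau> (x + a) * T / (theta \<tau> x * theta \<tau> a)" for x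
    by (simp add: varphi_eq e_def a_def da_def T_def mult.assoc)
  have vb: "varphi \<tau> \<beta> x = e (x * db) * theta \<tau> (x + b) * T / (theta \<tau> x * theta \<tau> b)" for x
    by (simp add: varphi_eq e_def b_def db_def T_def mult.assoc)
  have vc: "varphi \<tau> \<gamma> x = e (x * dc) * theta \<tau> (x + c) * T / (theta \<tau> x * theta \<tau> c)" for x
    by (simp add: varphi_eq e_def c_def dc_def T_def mult.assoc)
  have "E2 \<tau> w - E2 \<tau> z = T\<^sup>2 * theta \<tau> (z + w) * theta \<tau> (z - w) / ((theta \<tau> z)\<^sup>2 * (theta \<tau> w)\<^sup>2)"
    using E2_diff[OF z(1,2)] by (simp add: T_def field_simps)
  then have "varphi \<tau> \<alpha> (z + w) * (E2 \<tau> w - E2 \<tau> z) =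
     T ^ 3 / (theta \<tau> a * theta \<tau> b * theta \<tau> c * (theta \<tau> z)\<^sup>2 * (theta \<tau> w)\<^sup>2) *
     (e ((z + w) * da) * (theta \<tau> (z + w + a) * theta \<tau> (z - w) * (theta \<tau> b * theta \<tau> c)))"
    unfolding va using nz z by (simp add: power2_eq_square power3_eq_cube mult_ac)
  also have "\<dots> = varphi \<tau> \<alpha> z * varphi \<tau> \<beta> w * varphi \<tau> \<gamma> w - varphi \<tau> \<alpha> w * varphi \<tau> \<beta> z * varphi \<tau> \<gamma> z"
    unfolding key va vb vc right_diff_distrib using nz z
    by (intro arg_cong2[of _ _ _ _ "(-)"]) (simp_all add: power2_eq_square power3_eq_cube mult_ac)
  finally show ?thesis .
qed

text \<open>The right-hand side is symmetric in \<beta> and \<gamma>, so they may be ordered such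
  that omega_\<alpha> - omega_\<beta> is plus or minus omega_\<gamma>, by omega_3 = omega_1 +
  omega_2. For the minus sign, \<open>theta_omega_shift\<close> returns to plus.\<close>

lemma varphi_addition:
  assumes abc: "(\<alpha>, \<beta>, \<gamma>) \<in> {(1, 2, 3), (2, 3, 1), (3, 1, 2)}"
    and z: "theta \<tau> z \<noteq> 0" "theta \<tau> w \<noteq> 0" "theta \<tau> (z + w) \<noteq> 0"
  shows "varphi \<tau> \<alpha> (z + w) * (E2 \<tau> w - E2 \<tau> z)
     = varphi \<tau> \<alpha> z * varphi \<tau> \<beta> w * varphi \<tau> \<gamma> w - varphi \<tau> \<alpha> w * varphi \<tau> \<beta> z * varphi \<tau> \<gamma> z"
proof -
  have "varphi \<tau> 3 (z + w) * (E2 \<tau> w - E2 \<tau> z)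
     = varphi \<tau> 3 z * varphi \<tau> 1 w * varphi \<tau> 2 w - varphi \<tau> 3 w * varphi \<tau> 1 z * varphi \<tau> 2 z"
  proof (rule varphi_addition_aux[where s = 1])
    fix v
    have "theta \<tau> (v + omega \<tau> 3 - omega \<tau> 1) = theta \<tau> (v + omega \<tau> 2)"
      by (rule arg_cong[of _ _ "theta \<tau>"]) (simp add: omega_def add_divide_distrib)
    then show "theta \<tau> (v + omega \<tau> 3 - omega \<tau> 1) =
       1 * exp (2 * of_real pi * \<i> * v * (d_omega \<tau> 1 + d_omega \<tau> 2 - d_omega \<tau> 3)) * theta \<tau> (v + omega \<tau> 2)"
      by (simp add: d_omega_eq)
  qed (use z in auto)
  moreover have "varphi \<tau> 1 (z + w) * (E2 \<tau> w - E2 \<tau> z)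
     = varphi \<tau> 1 z * varphi \<tau> 3 w * varphi \<tau> 2 w - varphi \<tau> 1 w * varphi \<tau> 3 z * varphi \<tau> 2 z"
  proof (rule varphi_addition_aux[where s = "-1"])
    fix v
    have "theta \<tau> (v + omega \<tau> 1 - omega \<tau> 3) = theta \<tau> (v - omega \<tau> 2)"
      by (rule arg_cong[of _ _ "theta \<tau>"]) (simp add: omega_def add_divide_distrib)
    moreover define X where "X = 2 * of_real pi * \<i> * v"
    moreover have "theta \<tau> (v + omega \<tau> 2) = - exp (- X) * theta \<tau> (v - omega \<tau> 2)"
      using theta_omega_shift[of 2 v] by (simp add: d_omega_eq X_def mult_ac)
    moreover have "exp (- X) * exp X = 1" by (simp add: exp_add[symmetric])
    ultimately show "theta \<tau> (v + omega \<tau> 1 - omega \<tau> 3) =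
       - 1 * exp (2 * of_real pi * \<i> * v * (d_omega \<tau> 3 + d_omega \<tau> 2 - d_omega \<tau> 1)) * theta \<tau> (v + omega \<tau> 2)"
      by (simp add: d_omega_eq X_def[symmetric] mult.assoc[symmetric] mult.commute[of "exp X"])
  qed (use z in auto)
  moreover have "varphi \<tau> 2 (z + w) * (E2 \<tau> w - E2 \<tau> z)
     = varphi \<tau> 2 z * varphi \<tau> 3 w * varphi \<tau> 1 w - varphi \<tau> 2 w * varphi \<tau> 3 z * varphi \<tau> 1 z"
  proof (rule varphi_addition_aux[where s = "-1"])
    fix v
    have "theta \<tau> (v + omega \<tau> 2 - omega \<tau> 3) = theta \<tau> (v - omega \<tau> 1)"
      by (rule arg_cong[of _ _ "theta \<tau>"]) (simp add: omega_def add_divide_distrib)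
    then show "theta \<tau> (v + omega \<tau> 2 - omega \<tau> 3) =
       - 1 * exp (2 * of_real pi * \<i> * v * (d_omega \<tau> 3 + d_omega \<tau> 1 - d_omega \<tau> 2)) * theta \<tau> (v + omega \<tau> 1)"
      using theta_omega_shift[of 1 v] by (simp add: d_omega_eq)
  qed (use z in auto)
  ultimately show ?thesis using abc by (auto simp: mult_ac)
qed

text \<open>With z chosen first, every condition on w, including those on z + w and z - w, says that
  theta(s w + t) is nonzero for a pair (s, t); (- 1, z) stands for z - w. The reflection equation is
  thus not vacuous, on which uniqueness of the bracket rests.\<close>

lemma off_poles_exists: "\<exists>z w. off_poles \<tau> z w"
proof -
  have shift_hol: "(\<lambda>z. theta \<tau> (s * z + t)) holomorphic_on UNIV" for s t
  proof -
    have "(theta \<tau> \<circ> (\<lambda>z. s * z + t)) holomorphic_on UNIV"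
      by (rule holomorphic_on_compose_gen[OF _ theta_holomorphic[OF tau]]) (auto intro!: holomorphic_intros)
    then show ?thesis by (simp add: o_def)
  qed
  have shift_nz: "\<exists>z. theta \<tau> (s * z + t) \<noteq> 0" if "s \<noteq> 0" for s t
  proof -
    obtain u where "theta \<tau> u \<noteq> 0" using theta_not_identically_zero[OF tau] by blast
    then have "theta \<tau> (s * ((u - t) / s) + t) \<noteq> 0" using that by simp
    then show ?thesis by blast
  qed
  have common: "\<exists>z. \<forall>(s, t)\<in>I. theta \<tau> (s * z + t) \<noteq> 0" if "finite I" "\<And>s t. (s, t) \<in> I \<Longrightarrow> s \<noteq> 0" for I
    using entire_common_nonzero[of I "\<lambda>(s, t) z. theta \<tau> (s * z + t)"] that shift_hol shift_nz
    by (auto simp: case_prod_beta' split: prod.splits)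
  have "\<exists>z. \<forall>(s, t)\<in>{(1, 0), (1, - omega \<tau> 1), (1, - omega \<tau> 2), (1, - omega \<tau> 3)}. theta \<tau> (s * z + t) \<noteq> 0"
    by (rule common) auto
  then obtain z where z: "\<forall>(s, t)\<in>{(1, 0), (1, - omega \<tau> 1), (1, - omega \<tau> 2), (1, - omega \<tau> 3)}.
      theta \<tau> (s * z + t) \<noteq> 0" ..
  have "\<exists>w. \<forall>(s, t)\<in>{(1, 0), (1, - omega \<tau> 1), (1, - omega \<tau> 2), (1, - omega \<tau> 3), (1, z), (- 1, z)}.
      theta \<tau> (s * w + t) \<noteq> 0"
    by (rule common) auto
  then obtain w where w: "\<forall>(s, t)\<in>{(1, 0), (1, - omega \<tau> 1), (1, - omega \<tau> 2), (1, - omega \<tau> 3), (1, z), (- 1, z)}.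
      theta \<tau> (s * w + t) \<noteq> 0" ..
  from z w have "off_poles \<tau> z w" by (auto simp: off_poles_def add.commute)
  then show ?thesis by blast
qed

end

section \<open>The reflection equation in Pauli components\<close>

lemma UNIV_4': "UNIV = {0, 1, 2, 3 :: 4}"
proof -
  have 1: "{1, 2, 3, 4 :: 4} = {4, 1, 2, 3}" by blast
  have 2: "(4 :: 4) = 0" by simp
  show ?thesis unfolding UNIV_4 1 unfolding 2 ..
qed

lemma sum_4': "sum f (UNIV :: 4 set) = f 0 + f 1 + f 2 + f 3"
  unfolding UNIV_4' by (simp add: add.assoc)

lemma forall_4': "(\<forall>a::4. P a) \<longleftrightarrow> P 0 \<and> P 1 \<and> P 2 \<and> P 3"
proof -
  have "(\<forall>a::4. P a) \<longleftrightarrow> (\<forall>a\<in>{0, 1, 2, 3}. P a)"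
    unfolding UNIV_4'[symmetric] by blast
  then show ?thesis by simp
qed

lemma pauli_entries [simp]:
  "pauli 0 $ 1 $ 1 = 1" "pauli 0 $ 1 $ 2 = 0" "pauli 0 $ 2 $ 1 = 0" "pauli 0 $ 2 $ 2 = 1"
  "pauli 1 $ 1 $ 1 = 0" "pauli 1 $ 1 $ 2 = 1" "pauli 1 $ 2 $ 1 = 1" "pauli 1 $ 2 $ 2 = 0"
  "pauli 2 $ 1 $ 1 = 0" "pauli 2 $ 1 $ 2 = - \<i>" "pauli 2 $ 2 $ 1 = \<i>" "pauli 2 $ 2 $ 2 = 0"
  "pauli 3 $ 1 $ 1 = 1" "pauli 3 $ 1 $ 2 = 0" "pauli 3 $ 2 $ 1 = 0" "pauli 3 $ 2 $ 2 = - 1"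
  by (simp_all add: pauli_def mat_def)

lemma pauli_independent:
  assumes "\<And>i j. (\<Sum>a\<in>UNIV. t a * pauli a $ i $ j) = 0"
  shows "t a = 0"
proof -
  have "t 0 + t 3 = 0" "t 0 - t 3 = 0" "t 1 - \<i> * t 2 = 0" "t 1 + \<i> * t 2 = 0"
    using assms[of 1 1] assms[of 2 2] assms[of 1 2] assms[of 2 1]
    by (simp_all add: sum_4' mult.commute)
  then have "t 0 = 0" "t 3 = 0" "t 1 = 0" "\<i> * t 2 = 0" by algebra+
  then have "\<forall>a. t a = 0" by (simp add: forall_4')
  then show ?thesis by blast
qed

lemma pauli_kron_independent:
  assumes "\<And>i j k l. (\<Sum>a\<in>UNIV. \<Sum>b\<in>UNIV. t a b * pauli a $ i $ j * pauli b $ k $ l) = 0"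
  shows "t a b = 0"
proof -
  have "(\<Sum>b\<in>UNIV. t a b * pauli b $ k $ l) = 0" for k l
  proof (rule pauli_independent)
    fix i j
    show "(\<Sum>a\<in>UNIV. (\<Sum>b\<in>UNIV. t a b * pauli b $ k $ l) * pauli a $ i $ j) = 0"
      using assms[of i j k l] by (simp add: sum_distrib_right sum_distrib_left mult_ac)
  qed
  then show ?thesis by (rule pauli_independent)
qed

lemma kron_mult: "(A \<otimes> B) ** (C \<otimes> D) = (A ** C) \<otimes> (B ** D)"
proof -
  have "(\<Sum>r\<in>UNIV. g r) = (\<Sum>i\<in>UNIV. \<Sum>j\<in>UNIV. g (i, j))" for g :: "2 \<times> 2 \<Rightarrow> complex"
    by (simp add: sum.cartesian_product)
  then show ?thesis
    by (simp add: vec_eq_iff matrix_matrix_mult_def kron_def sum_product mult_ac)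
qed

lemma mult_sum_cscale:
  "A ** (\<Sum>a\<in>I. c a *\<^sub>m M a) = (\<Sum>a\<in>I. c a *\<^sub>m (A ** M a))"
  "(\<Sum>a\<in>I. c a *\<^sub>m M a) ** A = (\<Sum>a\<in>I. c a *\<^sub>m (M a ** A))"
proof -
  have "(\<Sum>k\<in>UNIV. A $ i $ k * (\<Sum>a\<in>I. c a * M a $ k $ j)) = (\<Sum>a\<in>I. c a * (\<Sum>k\<in>UNIV. A $ i $ k * M a $ k $ j))" for i j
    unfolding sum_distrib_left by (subst sum.swap) (simp add: mult_ac)
  then show "A ** (\<Sum>a\<in>I. c a *\<^sub>m M a) = (\<Sum>a\<in>I. c a *\<^sub>m (A ** M a))"
    by (simp add: vec_eq_iff matrix_matrix_mult_def cscale_def sum_component)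
  have "(\<Sum>k\<in>UNIV. (\<Sum>a\<in>I. c a * M a $ i $ k) * A $ k $ j) = (\<Sum>a\<in>I. c a * (\<Sum>k\<in>UNIV. M a $ i $ k * A $ k $ j))" for i j
    unfolding sum_distrib_left sum_distrib_right by (subst sum.swap) (simp add: mult_ac)
  then show "(\<Sum>a\<in>I. c a *\<^sub>m M a) ** A = (\<Sum>a\<in>I. c a *\<^sub>m (M a ** A))"
    by (simp add: vec_eq_iff matrix_matrix_mult_def cscale_def sum_component)
qed

text \<open>Theta functions are abstracted away: X and Y stand for the Lax matrices at z and w,
  \<open>m\<close> and \<open>p\<close> for the values of \<open>varphi\<close> at z - w and z + w.
  What remains is the algebra of Pauli matrices.\<close>

definition reflection_rhs ::
  "complex ^ 2 ^ 2 \<Rightarrow> complex ^ 2 ^ 2 \<Rightarrow> (4 \<Rightarrow> complex) \<Rightarrow> (4 \<Rightarrow> complex) \<Rightarrow> complex ^ (2 \<times> 2) ^ (2 \<times> 2)"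
where
  "reflection_rhs X Y m p =
     (let L1 = X \<otimes> pauli 0; L2 = pauli 0 \<otimes> Y;
          rm = (\<Sum>\<alpha>\<in>{1, 2, 3}. m \<alpha> *\<^sub>m (pauli \<alpha> \<otimes> pauli \<alpha>));
          rp = (\<Sum>\<alpha>\<in>{1, 2, 3}. p \<alpha> *\<^sub>m (pauli \<alpha> \<otimes> pauli \<alpha>)) in
      (1/2) *\<^sub>m commutator (L1 ** L2) rm + (1/2) *\<^sub>m (L2 ** rp ** L1) - (1/2) *\<^sub>m (L1 ** rp ** L2))"

lemma reflection_rhs_entry:
  "reflection_rhs X Y m p $ (i, k) $ (j, l) =
     1/2 * (\<Sum>\<alpha>\<in>{1, 2, 3}.
        m \<alpha> * ((X ** pauli \<alpha>) $ i $ j * (Y ** pauli \<alpha>) $ k $ l - (pauli \<alpha> ** X) $ i $ j * (pauli \<alpha> ** Y) $ k $ l)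
      + p \<alpha> * ((pauli \<alpha> ** X) $ i $ j * (Y ** pauli \<alpha>) $ k $ l - (X ** pauli \<alpha>) $ i $ j * (pauli \<alpha> ** Y) $ k $ l))"
proof -
  have "pauli 0 = mat 1" by (simp add: pauli_def)
  then have one: "pauli 0 ** A = A" "A ** pauli 0 = A" for A
    by (simp_all only: matrix_mul_lid matrix_mul_rid)
  define d where "d \<alpha> = m \<alpha> * ((X ** pauli \<alpha>) $ i $ j * (Y ** pauli \<alpha>) $ k $ l
      - (pauli \<alpha> ** X) $ i $ j * (pauli \<alpha> ** Y) $ k $ l)" for \<alpha>
  define e where "e \<alpha> = p \<alpha> * ((pauli \<alpha> ** X) $ i $ j * (Y ** pauli \<alpha>) $ k $ l
      - (X ** pauli \<alpha>) $ i $ j * (pauli \<alpha> ** Y) $ k $ l)" for \<alpha>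
  have "reflection_rhs X Y m p =
     (1/2) *\<^sub>m ((\<Sum>\<alpha>\<in>{1, 2, 3}. m \<alpha> *\<^sub>m ((X ** pauli \<alpha>) \<otimes> (Y ** pauli \<alpha>)))
       - (\<Sum>\<alpha>\<in>{1, 2, 3}. m \<alpha> *\<^sub>m ((pauli \<alpha> ** X) \<otimes> (pauli \<alpha> ** Y))))
     + (1/2) *\<^sub>m (\<Sum>\<alpha>\<in>{1, 2, 3}. p \<alpha> *\<^sub>m ((pauli \<alpha> ** X) \<otimes> (Y ** pauli \<alpha>)))
     - (1/2) *\<^sub>m (\<Sum>\<alpha>\<in>{1, 2, 3}. p \<alpha> *\<^sub>m ((X ** pauli \<alpha>) \<otimes> (pauli \<alpha> ** Y)))"
    unfolding reflection_rhs_def Let_def commutator_def mult_sum_cscale kron_mult one ..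
  then have "reflection_rhs X Y m p $ (i, k) $ (j, l) =
      1/2 * (\<Sum>\<alpha>\<in>{1, 2, 3}. d \<alpha>) + 1/2 * (\<Sum>\<alpha>\<in>{1, 2, 3}. e \<alpha>)"
    unfolding d_def e_def right_diff_distrib sum_subtractf
    by (simp only: vector_add_component vector_minus_component sum_component cscale_def kron_def
        vec_lambda_beta fst_conv snd_conv) (simp only: right_diff_distrib diff_diff_eq add_diff_eq)
  then show ?thesis unfolding d_def e_def sum.distrib distrib_left .
qed

text \<open>
  Only the components \<open>\<sigma>\<^sub>a \<otimes> \<sigma>\<^sub>b\<close> with \<open>a \<noteq> b\<close> survive; they come from the commutators of Pauli
  matrices.
\<close>
lemma reflection_rhs_components:
  assumes X: "\<And>i j. X $ i $ j = (\<Sum>a\<in>UNIV. x a * pauli a $ i $ j)"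
    and Y: "\<And>i j. Y $ i $ j = (\<Sum>a\<in>UNIV. y a * pauli a $ i $ j)"
    and xy: "x 0 = y 0"
    and diag: "\<And>a. R a a = 0"
    and cyc: "\<And>\<alpha> \<beta> \<gamma>. (\<alpha>, \<beta>, \<gamma>) \<in> {(1, 2, 3), (2, 3, 1), (3, 1, 2)} \<Longrightarrow>
      R \<alpha> \<beta> = \<i> * y 0 * ((p \<alpha> + m \<alpha>) * y \<gamma> + (p \<beta> - m \<beta>) * x \<gamma>) \<and>
      R \<beta> \<alpha> = - \<i> * y 0 * ((p \<beta> + m \<beta>) * y \<gamma> + (p \<alpha> - m \<alpha>) * x \<gamma>) \<and>
      R 0 \<alpha> = - \<i> * ((p \<beta> + m \<beta>) * x \<beta> * y \<gamma> - (p \<gamma> + m \<gamma>) * x \<gamma> * y \<beta>) \<and>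
      R \<alpha> 0 = \<i> * ((p \<beta> - m \<beta>) * x \<gamma> * y \<beta> - (p \<gamma> - m \<gamma>) * x \<beta> * y \<gamma>)"
  shows "reflection_rhs X Y m p $ (i, k) $ (j, l)
     = (\<Sum>a\<in>UNIV. \<Sum>b\<in>UNIV. R a b * pauli a $ i $ j * pauli b $ k $ l)"
proof -
  note c = cyc[of 1 2 3, simplified] cyc[of 2 3 1, simplified] cyc[of 3 1 2, simplified]
  have "\<forall>i j k l. reflection_rhs X Y m p $ (i, k) $ (j, l)
     = (\<Sum>a\<in>UNIV. \<Sum>b\<in>UNIV. R a b * pauli a $ i $ j * pauli b $ k $ l)"
    unfolding forall_2
    by (simp add: reflection_rhs_entry matrix_matrix_mult_def sum_2 X Y sum_4' c diag xy)
       (simp add: field_simps)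
  then show ?thesis by blast
qed

section \<open>Poisson brackets on the coordinate ring\<close>

lemmas polyfuns_intros [intro, simp] = polyfuns.intros

lemma polyfuns_uminus [intro, simp]: "f \<in> polyfuns \<Longrightarrow> (\<lambda>S. - f S) \<in> polyfuns"
  using polyfuns.mult[OF polyfuns.const[of "-1"]] by simp

lemma polyfuns_diff [intro, simp]: "f \<in> polyfuns \<Longrightarrow> g \<in> polyfuns \<Longrightarrow> (\<lambda>S. f S - g S) \<in> polyfuns"
  using polyfuns.add[OF _ polyfuns_uminus, of f g] by simp

lemma polyfuns_sum [intro, simp]:
  "(\<And>i. i \<in> I \<Longrightarrow> f i \<in> polyfuns) \<Longrightarrow> (\<lambda>S. \<Sum>i\<in>I. f i S) \<in> polyfuns"
  by (induction I rule: infinite_finite_induct) auto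

section \<open>Calculus of skew biderivations\<close>

locale skew_bider =
  fixes P :: bracket
  assumes bider: "skew_biderivation P"
begin

lemma closed [simp]: "f \<in> polyfuns \<Longrightarrow> g \<in> polyfuns \<Longrightarrow> P f g \<in> polyfuns"
  using bider unfolding skew_biderivation_def by blast

text \<open>This rule and the following ones equate functions rather than values, so that they also
  rewrite the inner bracket of an expression such as \<open>P f (P g h)\<close>.\<close>

lemma skew: "f \<in> polyfuns \<Longrightarrow> g \<in> polyfuns \<Longrightarrow> P f g = (\<lambda>S. - P g f S)"
  using bider unfolding skew_biderivation_def by (intro ext) blast

lemma add_left:
  "f \<in> polyfuns \<Longrightarrow> g \<in> polyfuns \<Longrightarrow> h \<in> polyfuns \<Longrightarrow> P (\<lambda>x. f x + g x) h = (\<lambda>S. P f h S + P g h S)"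
  using bider unfolding skew_biderivation_def by (intro ext) blast

lemma scale_left: "f \<in> polyfuns \<Longrightarrow> h \<in> polyfuns \<Longrightarrow> P (\<lambda>x. c * f x) h = (\<lambda>S. c * P f h S)"
  using bider unfolding skew_biderivation_def by (intro ext) blast

lemma mult_left:
  "f \<in> polyfuns \<Longrightarrow> g \<in> polyfuns \<Longrightarrow> h \<in> polyfuns \<Longrightarrow>
     P (\<lambda>x. f x * g x) h = (\<lambda>S. f S * P g h S + P f h S * g S)"
  using bider unfolding skew_biderivation_def by (intro ext) blast

text \<open>The Leibniz rule for 1 = 1 * 1 gives P(1, h) = 2 P(1, h).\<close>

lemma const_left:
  assumes "h \<in> polyfuns"
  shows "P (\<lambda>x. c) h = (\<lambda>S. 0)"
proof -
  have "P (\<lambda>x. 1) h = (\<lambda>S. 0)"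
    using mult_left[of "\<lambda>x. 1" "\<lambda>x. 1" h] assms by (simp add: fun_eq_iff)
  then show ?thesis using scale_left[of "\<lambda>x. 1" h c] assms by simp
qed

lemma add_right:
  "f \<in> polyfuns \<Longrightarrow> g \<in> polyfuns \<Longrightarrow> h \<in> polyfuns \<Longrightarrow> P h (\<lambda>x. f x + g x) = (\<lambda>S. P h f S + P h g S)"
  by (simp add: skew[of h] add_left)

lemma scale_right: "f \<in> polyfuns \<Longrightarrow> h \<in> polyfuns \<Longrightarrow> P h (\<lambda>x. c * f x) = (\<lambda>S. c * P h f S)"
  by (simp add: skew[of h] scale_left)

lemma mult_right:
  "f \<in> polyfuns \<Longrightarrow> g \<in> polyfuns \<Longrightarrow> h \<in> polyfuns \<Longrightarrow>
     P h (\<lambda>x. f x * g x) = (\<lambda>S. f S * P h g S + P h f S * g S)"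
  by (simp add: skew[of h] mult_left)

lemma const_right: "h \<in> polyfuns \<Longrightarrow> P h (\<lambda>x. c) = (\<lambda>S. 0)"
  by (simp add: skew[of h] const_left)

lemma uminus_right: "f \<in> polyfuns \<Longrightarrow> h \<in> polyfuns \<Longrightarrow> P h (\<lambda>x. - f x) = (\<lambda>S. - P h f S)"
  using scale_right[of f h "- 1"] by simp

lemma diff_right:
  "f \<in> polyfuns \<Longrightarrow> g \<in> polyfuns \<Longrightarrow> h \<in> polyfuns \<Longrightarrow> P h (\<lambda>x. f x - g x) = (\<lambda>S. P h f S - P h g S)"
  using add_right[of f "\<lambda>x. - g x" h] by (simp add: uminus_right)

lemma sum_left:
  "(\<And>i. i \<in> I \<Longrightarrow> f i \<in> polyfuns) \<Longrightarrow> h \<in> polyfuns \<Longrightarrow> P (\<lambda>x. \<Sum>i\<in>I. f i x) h = (\<lambda>S. \<Sum>i\<in>I. P (f i) h S)"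
  by (induction I rule: infinite_finite_induct) (simp_all add: const_left add_left)

lemma sum_right:
  "(\<And>i. i \<in> I \<Longrightarrow> f i \<in> polyfuns) \<Longrightarrow> h \<in> polyfuns \<Longrightarrow> P h (\<lambda>x. \<Sum>i\<in>I. f i x) = (\<lambda>S. \<Sum>i\<in>I. P h (f i) S)"
  by (induction I rule: infinite_finite_induct) (simp_all add: const_right add_right)

text \<open>The constants drop out: in the bracket of two Lax matrices the terms with \<nu> leave no
  trace, and they enter only through the right-hand side of the reflection equation.\<close>

lemma affine:
  "P (\<lambda>x. (\<Sum>a\<in>UNIV. u a * x $ a) + c) (\<lambda>x. (\<Sum>b\<in>UNIV. v b * x $ b) + d) S
     = (\<Sum>a\<in>UNIV. \<Sum>b\<in>UNIV. u a * v b * P (\<lambda>x. x $ a) (\<lambda>x. x $ b) S)"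
  by (simp add: add_left add_right const_left const_right sum_left sum_right scale_left scale_right
      sum_distrib_left mult_ac)

definition jacobiator :: "(complex ^ 4 \<Rightarrow> complex) \<Rightarrow> (complex ^ 4 \<Rightarrow> complex) \<Rightarrow> (complex ^ 4 \<Rightarrow> complex)
    \<Rightarrow> complex ^ 4 \<Rightarrow> complex" where
  "jacobiator f g h S = P f (P g h) S + P g (P h f) S + P h (P f g) S"

lemma jacobiator_cyclic: "jacobiator f g h S = jacobiator g h f S"
  by (simp add: jacobiator_def)

text \<open>The Jacobiator is a derivation in its first argument.\<close>
lemma jacobiator_zero_left:
  assumes coord: "\<And>a S. jacobiator (\<lambda>x. x $ a) g h S = 0" and gh: "g \<in> polyfuns" "h \<in> polyfuns"
    and f: "f \<in> polyfuns"
  shows "jacobiator f g h S = 0"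
  using f
proof (induction arbitrary: S rule: polyfuns.induct)
  case (const c)
  then show ?case using gh by (simp add: jacobiator_def const_left const_right)
next
  case (coord a)
  then show ?case using assms(1) by blast
next
  case (add f1 f2)
  have "jacobiator (\<lambda>S. f1 S + f2 S) g h S = jacobiator f1 g h S + jacobiator f2 g h S"
    using add.hyps gh by (simp add: jacobiator_def add_left add_right)
  then show ?case using add by simp
next
  case (mult f1 f2)
  have "jacobiator (\<lambda>S. f1 S * f2 S) g h S = f1 S * jacobiator f2 g h S + jacobiator f1 g h S * f2 S"
  proof -
    \<comment> \<open>Stated for both orders of g and h: the mixed terms, products of two
      first-order brackets, are symmetric under the exchange and cancel in the difference.\<close>
    have 1: "P g (P h (\<lambda>S. f1 S * f2 S)) =
      (\<lambda>S. f1 S * P g (P h f2) S + P g f1 S * P h f2 S + (P h f1 S * P g f2 S + P g (P h f1) S * f2 S))" if "g \<in> polyfuns" "h \<in> polyfuns" for g h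
      using mult.hyps that by (simp add: mult_right add_right)
    have 2: "P h (P (\<lambda>S. f1 S * f2 S) g) S = - P h (P g (\<lambda>S. f1 S * f2 S)) S"
      "P h (P f1 g) S = - P h (P g f1) S" "P h (P f2 g) S = - P h (P g f2) S"
      using mult.hyps gh by (simp_all add: skew[of _ g] uminus_right)
    show ?thesis using mult.hyps gh
      by (simp add: jacobiator_def 2 1 mult_left[of f1 f2 "P g h"]) (simp add: algebra_simps)
  qed
  then show ?case using mult by simp
qed

text \<open>The Jacobiator is invariant under cyclic rotation, so the derivation property in the
  first slot serves all three: each rotation brings another slot to the front, where coordinates are
  replaced by arbitrary polynomials.\<close>

lemma poisson_if_coordinates:
  assumes "\<And>a b c S. jacobiator (\<lambda>x. x $ a) (\<lambda>x. x $ b) (\<lambda>x. x $ c) S = 0"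
  shows "poisson_bracket P"
proof -
  have 1: "jacobiator f (\<lambda>x. x $ b) (\<lambda>x. x $ c) S = 0" if "f \<in> polyfuns" for f b c S
    by (rule jacobiator_zero_left) (simp_all add: that assms)
  have 2: "jacobiator f g (\<lambda>x. x $ c) S = 0" if fg: "f \<in> polyfuns" "g \<in> polyfuns" for f g c S
  proof -
    have "jacobiator (\<lambda>x. x $ a) (\<lambda>x. x $ c) f S = 0" for a S
      using 1[OF fg(1), of a c S] jacobiator_cyclic[of f "\<lambda>x. x $ a" "\<lambda>x. x $ c" S] by simp
    then have "jacobiator g (\<lambda>x. x $ c) f S = 0"
      by (rule jacobiator_zero_left) (simp_all add: fg)
    then show ?thesis using jacobiator_cyclic[of f g "\<lambda>x. x $ c" S] by simp
  qed
  have "jacobiator f g h S = 0" if fgh: "f \<in> polyfuns" "g \<in> polyfuns" "h \<in> polyfuns" for f g h S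
  proof -
    have "jacobiator (\<lambda>x. x $ a) f g S = 0" for a S
      using 2[OF fgh(1,2), of a S] jacobiator_cyclic[of "\<lambda>x. x $ a" f g S] by simp
    then have "jacobiator h f g S = 0"
      by (rule jacobiator_zero_left) (simp_all add: fgh)
    then show ?thesis using jacobiator_cyclic[of h f g S] by simp
  qed
  then show ?thesis
    using bider unfolding poisson_bracket_def jacobiator_def by simp
qed

end

lemma skew_biderivation_determined:
  assumes P: "skew_biderivation P" and Q: "skew_biderivation Q"
    and coord: "\<And>a b S. P (\<lambda>x. x $ a) (\<lambda>x. x $ b) S = Q (\<lambda>x. x $ a) (\<lambda>x. x $ b) S"
    and f: "f \<in> polyfuns" and g: "g \<in> polyfuns"
  shows "P f g = Q f g"
proof -
  interpret P: skew_bider P by unfold_locales (rule P)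
  interpret Q: skew_bider Q by unfold_locales (rule Q)
  have 0: "P (\<lambda>x. x $ a) (\<lambda>x. x $ b) = Q (\<lambda>x. x $ a) (\<lambda>x. x $ b)" for a b
    using coord by (intro ext) blast
  have 1: "P f (\<lambda>x. x $ b) = Q f (\<lambda>x. x $ b)" if "f \<in> polyfuns" for f b
    using that
    by (induction rule: polyfuns.induct)
       (simp_all add: 0 P.const_left Q.const_left P.add_left Q.add_left P.mult_left Q.mult_left)
  show ?thesis
    using g
    by (induction rule: polyfuns.induct)
       (simp_all add: f 1 P.const_right Q.const_right P.add_right Q.add_right P.mult_right Q.mult_right)
qed

section \<open>Brackets from bivector fields\<close>

definition pdiff :: "4 \<Rightarrow> (complex ^ 4 \<Rightarrow> complex) \<Rightarrow> complex ^ 4 \<Rightarrow> complex" where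
  "pdiff a f S = deriv (\<lambda>t. f (S + t *s axis a 1)) 0"

text \<open>Differentiability and polynomiality of the derivative go through one induction:
  \<open>deriv\<close> in \<open>pdiff\<close> is informative only once a derivative exists, and
  closure of the bracket on the ring requires it to be polynomial.\<close>

lemma pdiff_exists:
  assumes "f \<in> polyfuns"
  shows "\<exists>g\<in>polyfuns. \<forall>S. ((\<lambda>t. f (S + t *s axis a 1)) has_field_derivative g S) (at 0)"
  using assms
proof (induction rule: polyfuns.induct)
  case (const c)
  show ?case by (rule bexI[of _ "\<lambda>S. 0"]) auto
next
  case (coord b)
  show ?case
    by (rule bexI[of _ "\<lambda>S. axis a 1 $ b"]) (auto intro!: derivative_eq_intros)
next
  case (add f g)
  then obtain f' g' where fg: "f' \<in> polyfuns" "g' \<in> polyfuns"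
    "\<And>S. ((\<lambda>t. f (S + t *s axis a 1)) has_field_derivative f' S) (at 0)"
    "\<And>S. ((\<lambda>t. g (S + t *s axis a 1)) has_field_derivative g' S) (at 0)" by blast
  show ?case
    by (rule bexI[of _ "\<lambda>S. f' S + g' S"]) (use fg in \<open>auto intro: DERIV_add\<close>)
next
  case (mult f g)
  then obtain f' g' where fg: "f' \<in> polyfuns" "g' \<in> polyfuns"
    "\<And>S. ((\<lambda>t. f (S + t *s axis a 1)) has_field_derivative f' S) (at 0)"
    "\<And>S. ((\<lambda>t. g (S + t *s axis a 1)) has_field_derivative g' S) (at 0)" by blast
  have "((\<lambda>t. f (S + t *s axis a 1) * g (S + t *s axis a 1)) has_field_derivative
      f' S * g S + g' S * f S) (at 0)" for S
    using DERIV_mult[OF fg(3)[of S] fg(4)[of S]] by simp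
  then show ?case
    by (intro bexI[of _ "\<lambda>S. f' S * g S + g' S * f S"]) (use fg mult in auto)
qed

lemma
  assumes "f \<in> polyfuns"
  shows pdiff_polyfuns [simp]: "pdiff a f \<in> polyfuns"
    and pdiff_DERIV: "((\<lambda>t. f (S + t *s axis a 1)) has_field_derivative pdiff a f S) (at 0)"
proof -
  obtain g where g: "g \<in> polyfuns" "\<And>S. ((\<lambda>t. f (S + t *s axis a 1)) has_field_derivative g S) (at 0)"
    using pdiff_exists[OF assms] by blast
  then have "pdiff a f = g"
    by (auto simp: pdiff_def fun_eq_iff intro: DERIV_imp_deriv)
  with g show "pdiff a f \<in> polyfuns" "((\<lambda>t. f (S + t *s axis a 1)) has_field_derivative pdiff a f S) (at 0)"
    by auto
qed

lemma pdiff_add: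
  "f \<in> polyfuns \<Longrightarrow> g \<in> polyfuns \<Longrightarrow> pdiff a (\<lambda>x. f x + g x) S = pdiff a f S + pdiff a g S"
  unfolding pdiff_def[of a "\<lambda>x. f x + g x"]
  by (intro DERIV_imp_deriv DERIV_add pdiff_DERIV)

lemma pdiff_mult:
  assumes "f \<in> polyfuns" "g \<in> polyfuns"
  shows "pdiff a (\<lambda>x. f x * g x) S = f S * pdiff a g S + pdiff a f S * g S"
  unfolding pdiff_def[of a "\<lambda>x. f x * g x"]
  using DERIV_mult[OF pdiff_DERIV[OF assms(1), of S a] pdiff_DERIV[OF assms(2), of S a]]
  by (intro DERIV_imp_deriv) (simp add: algebra_simps)

lemma pdiff_const: "pdiff a (\<lambda>x. c) S = 0"
  by (simp add: pdiff_def)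

lemma pdiff_coord: "pdiff a (\<lambda>x. x $ b) S = (if a = b then 1 else 0)"
proof -
  have "((\<lambda>t. (S + t *s axis a 1) $ b) has_field_derivative (if a = b then 1 else 0)) (at 0)"
    by (auto intro!: derivative_eq_intros simp: axis_def)
  then show ?thesis unfolding pdiff_def by (rule DERIV_imp_deriv)
qed

text \<open>Contraction of the bivector field \<open>B\<close> with the differentials of f and g:
  for skew polynomial \<open>B\<close> a skew biderivation with prescribed brackets of coordinates,
  hence the witness for existence.\<close>

definition bivector_bracket :: "(complex ^ 4 \<Rightarrow> 4 \<Rightarrow> 4 \<Rightarrow> complex) \<Rightarrow> bracket" where
  "bivector_bracket B f g = (\<lambda>S. \<Sum>a\<in>UNIV. \<Sum>b\<in>UNIV. B S a b * pdiff a f S * pdiff b g S)"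

lemma bivector_bracket_coord: "bivector_bracket B (\<lambda>x. x $ a) (\<lambda>x. x $ b) = (\<lambda>S. B S a b)"
proof
  fix S
  have "(\<Sum>b'\<in>UNIV. B S a' b' * pdiff a' (\<lambda>x. x $ a) S * pdiff b' (\<lambda>x. x $ b) S) = (if a' = a then B S a b else 0)" for a'
    by (simp add: pdiff_coord if_distrib[of "\<lambda>t. _ * t"] sum.delta cong: if_cong)
  then show "bivector_bracket B (\<lambda>x. x $ a) (\<lambda>x. x $ b) S = B S a b"
    by (simp add: bivector_bracket_def)
qed

lemma bivector_bracket_skew_biderivation:
  assumes poly: "\<And>a b. (\<lambda>S. B S a b) \<in> polyfuns" and skew: "\<And>S a b. B S a b = - B S b a"
  shows "skew_biderivation (bivector_bracket B)"
  unfolding skew_biderivation_def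
proof (intro conjI ballI allI)
  fix f g h :: "complex ^ 4 \<Rightarrow> complex" and S c
  assume f: "f \<in> polyfuns"
  show "bivector_bracket B (\<lambda>x. c * f x) h S = c * bivector_bracket B f h S"
    using f by (simp add: bivector_bracket_def pdiff_mult pdiff_const sum_distrib_left mult_ac)
  assume g: "g \<in> polyfuns"
  show "bivector_bracket B f g \<in> polyfuns"
    unfolding bivector_bracket_def using f g poly by auto
  show "bivector_bracket B f g S = - bivector_bracket B g f S"
  proof -
    have "bivector_bracket B f g S = (\<Sum>b\<in>UNIV. \<Sum>a\<in>UNIV. B S a b * pdiff a f S * pdiff b g S)"
      unfolding bivector_bracket_def by (rule sum.swap)
    also have "\<dots> = (\<Sum>b\<in>UNIV. \<Sum>a\<in>UNIV. - (B S b a * pdiff b g S * pdiff a f S))"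
    proof (intro sum.cong refl)
      fix a b
      show "B S a b * pdiff a f S * pdiff b g S = - (B S b a * pdiff b g S * pdiff a f S)"
        unfolding skew[of S a b] by simp
    qed
    finally show ?thesis by (simp add: bivector_bracket_def sum_negf)
  qed
  show "bivector_bracket B (\<lambda>x. f x + g x) h S = bivector_bracket B f h S + bivector_bracket B g h S"
    using f g by (simp add: bivector_bracket_def pdiff_add algebra_simps sum.distrib)
  show "bivector_bracket B (\<lambda>x. f x * g x) h S = f S * bivector_bracket B g h S + bivector_bracket B f h S * g S"
    using f g by (simp add: bivector_bracket_def pdiff_mult algebra_simps sum.distrib sum_distrib_left sum_distrib_right)
qed

text \<open>The Sklyanin bracket with arbitrary constants \<open>e\<close> and an additional linear
  part given by \<open>n\<close>. They later become E2(omega_\<alpha>) and \<open>nu'\<close>;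
  keeping them free makes Jacobi a polynomial identity. \<open>F\<close> copies the sums of the
  theorem.\<close>

definition sklyanin_tensor :: "(4 \<Rightarrow> complex) \<Rightarrow> (4 \<Rightarrow> complex) \<Rightarrow> complex ^ 4 \<Rightarrow> 4 \<Rightarrow> 4 \<Rightarrow> complex" where
  "sklyanin_tensor e n S a b =
    (let F = (\<lambda>\<alpha>. \<Sum>\<beta>\<in>{1, 2, 3}. \<Sum>\<gamma>\<in>{1, 2, 3}.
            \<i> * levi_civita \<alpha> \<beta> \<gamma> * S $ \<beta> * S $ \<gamma> * (e \<beta> - e \<gamma>)
            + 2 * \<i> * levi_civita \<alpha> \<beta> \<gamma> * S $ \<beta> * n \<gamma>) in
     if a = 0 then (if b = 0 then 0 else F b)
     else if b = 0 then - F a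
     else 2 * \<i> * (\<Sum>\<gamma>\<in>{1, 2, 3}. levi_civita a b \<gamma> * S $ 0 * S $ \<gamma>))"

text \<open>In the double sum only (\<beta>, \<gamma>) and (\<gamma>, \<beta>) survive. Under the
  exchange both \<open>levi_civita\<close> and e_\<beta> - e_\<gamma> change sign, so the quadratic
  part doubles while the linear part is antisymmetrised.\<close>

lemma sklyanin_tensor_simps:
  "sklyanin_tensor e n S a a = 0"
  "(\<alpha>, \<beta>, \<gamma>) \<in> {(1, 2, 3), (2, 3, 1), (3, 1, 2)} \<Longrightarrow> sklyanin_tensor e n S \<alpha> \<beta> = 2 * \<i> * S $ 0 * S $ \<gamma>"
  "(\<alpha>, \<beta>, \<gamma>) \<in> {(1, 2, 3), (2, 3, 1), (3, 1, 2)} \<Longrightarrow> sklyanin_tensor e n S 0 \<alpha>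
     = 2 * \<i> * (S $ \<beta> * S $ \<gamma> * (e \<beta> - e \<gamma>) + S $ \<beta> * n \<gamma> - S $ \<gamma> * n \<beta>)"
proof -
  have "\<forall>a. sklyanin_tensor e n S a a = 0"
    unfolding forall_4' by (simp add: sklyanin_tensor_def levi_civita_def)
  then show "sklyanin_tensor e n S a a = 0" by blast
qed (elim insertE; simp add: sklyanin_tensor_def levi_civita_def; simp add: algebra_simps)+

lemma sklyanin_tensor_skew: "sklyanin_tensor e n S a b = - sklyanin_tensor e n S b a"
proof -
  have "\<forall>a b. sklyanin_tensor e n S a b = - sklyanin_tensor e n S b a"
    unfolding forall_4' by (simp add: sklyanin_tensor_def levi_civita_def)
  then show ?thesis by blast
qed

lemmas sklyanin_tensor_table =
  sklyanin_tensor_simps(1)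
  sklyanin_tensor_simps(2)[of 1 2 3, simplified] sklyanin_tensor_simps(2)[of 2 3 1, simplified]
  sklyanin_tensor_simps(2)[of 3 1 2, simplified]
  sklyanin_tensor_simps(3)[of 1 2 3, simplified] sklyanin_tensor_simps(3)[of 2 3 1, simplified]
  sklyanin_tensor_simps(3)[of 3 1 2, simplified]
  sklyanin_tensor_skew[of _ _ _ 2 1] sklyanin_tensor_skew[of _ _ _ 3 2] sklyanin_tensor_skew[of _ _ _ 1 3]
  sklyanin_tensor_skew[of _ _ _ 1 0] sklyanin_tensor_skew[of _ _ _ 2 0] sklyanin_tensor_skew[of _ _ _ 3 0]

lemma sklyanin_tensor_polyfuns: "(\<lambda>S. sklyanin_tensor e n S a b) \<in> polyfuns"
proof -
  have "\<forall>a b. (\<lambda>S. sklyanin_tensor e n S a b) \<in> polyfuns"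
    unfolding forall_4' by (simp add: sklyanin_tensor_table)
  then show ?thesis by blast
qed

text \<open>For S = (S_1, S_2, S_3) the Jacobiator of S_1, S_2, S_3 vanishes because the differences
  e_\<beta> - e_\<gamma> sum to 0 over the cycle and S . (S x n) = 0. That of S_0, S_\<alpha>,
  S_\<beta> vanishes by the same sum of differences and pairwise cancellation of the terms with
  n.\<close>

lemma sklyanin_bracket_poisson: "poisson_bracket (bivector_bracket (sklyanin_tensor e n))"
proof -
  define P where "P = bivector_bracket (sklyanin_tensor e n)"
  interpret skew_bider P
    unfolding P_def
    by unfold_locales (intro bivector_bracket_skew_biderivation sklyanin_tensor_polyfuns sklyanin_tensor_skew)
  have Px: "P (\<lambda>S. S $ a) (\<lambda>S. S $ b) = (\<lambda>S. sklyanin_tensor e n S a b)" for a b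
    unfolding P_def by (rule bivector_bracket_coord)
  note rules = add_right diff_right mult_right const_right uminus_right
  have "\<forall>a b c. jacobiator (\<lambda>S. S $ a) (\<lambda>S. S $ b) (\<lambda>S. S $ c) S = 0" for S
    unfolding forall_4' jacobiator_def
    by (simp add: Px sklyanin_tensor_table rules) (simp add: algebra_simps)
  then show ?thesis
    using poisson_if_coordinates unfolding P_def by blast
qed

section \<open>The bracket defined by the reflection equation\<close>

text \<open>The letters: aa, ab, ac are the values of varphi_\<alpha>, varphi_\<beta>,
  varphi_\<gamma> at z, and ba, bb, bc those at w; Z, W are \<open>E2\<close> at z, w; pa, ma belong
  to z + w, z - w; xb, xc, yb, yc are Lax coefficients at z and w; s is S_0. The four claims are the
  components (\<alpha>, \<beta>), (\<beta>, \<alpha>), (0, \<alpha>) and (\<alpha>, 0).\<close>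

lemma reflection_component_identities:
  fixes D Z W s :: complex
  assumes D: "D = W - Z" "D \<noteq> 0"
    and a2: "aa\<^sup>2 = Z - ea" "ab\<^sup>2 = Z - eb" "ac\<^sup>2 = Z - ec"
    and b2: "ba\<^sup>2 = W - ea" "bb\<^sup>2 = W - eb" "bc\<^sup>2 = W - ec"
    and nz: "aa \<noteq> 0" "ab \<noteq> 0" "ac \<noteq> 0" "ba \<noteq> 0" "bb \<noteq> 0" "bc \<noteq> 0"
    and p: "pa * D = aa * bb * bc - ba * ab * ac" "pb * D = ab * bc * ba - bb * ac * aa"
      "pc * D = ac * ba * bb - bc * aa * ab"
    and m: "ma * D = aa * bb * bc + ba * ab * ac" "mb * D = ab * bc * ba + bb * ac * aa"
      "mc * D = ac * ba * bb + bc * aa * ab"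
    and x: "xb = Sb * ab + nb / ab" "xc = Sc * ac + nc / ac"
    and y: "yb = Sb * bb + nb / bb" "yc = Sc * bc + nc / bc"
  shows "2 * \<i> * s * Sc * aa * bb = \<i> * s * ((pa + ma) * yc + (pb - mb) * xc)"
    and "- (2 * \<i> * s * Sc) * ab * ba = - \<i> * s * ((pb + mb) * yc + (pa - ma) * xc)"
    and "2 * \<i> * (Sb * Sc * (eb - ec) + Sb * nc - Sc * nb) * ba
           = - \<i> * ((pb + mb) * xb * yc - (pc + mc) * xc * yb)"
    and "- (2 * \<i> * (Sb * Sc * (eb - ec) + Sb * nc - Sc * nb)) * aa
           = \<i> * ((pb - mb) * xc * yb - (pc - mc) * xb * yc)"
proof -
  \<comment> \<open>Multiplying a Lax coefficient by its own value of \<open>varphi\<close> clears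
    the quotient and makes it affine in Z.\<close>
  have X: "ab * xb = Sb * (Z - eb) + nb" "ac * xc = Sc * (Z - ec) + nc"
    using nz unfolding x a2[symmetric] by (simp_all add: field_simps power2_eq_square)
  have Y: "bb * yb = Sb * (W - eb) + nb" "bc * yc = Sc * (W - ec) + nc"
    using nz unfolding y b2[symmetric] by (simp_all add: field_simps power2_eq_square)
  \<comment> \<open>The values at z + w and z - w involve the same two products with opposite sign
    of the second, so sum and difference each isolate one.\<close>
  have pm: "D * (pa + ma) = 2 * aa * bb * bc" "D * (pb + mb) = 2 * ab * bc * ba" "D * (pc + mc) = 2 * ac * ba * bb"
    "D * (pa - ma) = - 2 * ba * ab * ac" "D * (pb - mb) = - 2 * bb * ac * aa" "D * (pc - mc) = - 2 * bc * aa * ab"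
    using p m by (simp_all add: algebra_simps)
  \<comment> \<open>The terms with Z W cancel, which leaves a multiple of W - Z; the cofactor is the
    bracket of S_0 with S_\<alpha> up to a constant.\<close>
  have cross: "(ab * xb) * (bc * yc) - (ac * xc) * (bb * yb) = - D * (Sb * Sc * (eb - ec) + Sb * nc - Sc * nb)"
    unfolding X Y D(1) by (simp add: algebra_simps)
  have diff: "bc * yc - ac * xc = D * Sc"
    unfolding X Y D(1) by (simp add: algebra_simps)
  have "D * (\<i> * s * ((pa + ma) * yc + (pb - mb) * xc))
      = \<i> * s * ((D * (pa + ma)) * yc + (D * (pb - mb)) * xc)" by (simp add: algebra_simps)
  also have "\<dots> = 2 * \<i> * s * aa * bb * (bc * yc - ac * xc)" unfolding pm by (simp add: algebra_simps)
  also have "\<dots> = D * (2 * \<i> * s * Sc * aa * bb)" unfolding diff by (simp add: algebra_simps)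
  finally show "2 * \<i> * s * Sc * aa * bb = \<i> * s * ((pa + ma) * yc + (pb - mb) * xc)"
    using D(2) mult_left_cancel by metis
  have "D * (- \<i> * s * ((pb + mb) * yc + (pa - ma) * xc))
      = - \<i> * s * ((D * (pb + mb)) * yc + (D * (pa - ma)) * xc)" by (simp add: algebra_simps)
  also have "\<dots> = - 2 * \<i> * s * ab * ba * (bc * yc - ac * xc)" unfolding pm by (simp add: algebra_simps)
  also have "\<dots> = D * (- (2 * \<i> * s * Sc) * ab * ba)" unfolding diff by (simp add: algebra_simps)
  finally show "- (2 * \<i> * s * Sc) * ab * ba = - \<i> * s * ((pb + mb) * yc + (pa - ma) * xc)"
    using D(2) mult_left_cancel by metis
  have "D * (- \<i> * ((pb + mb) * xb * yc - (pc + mc) * xc * yb))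
      = - \<i> * ((D * (pb + mb)) * xb * yc - (D * (pc + mc)) * xc * yb)" by (simp add: algebra_simps)
  also have "\<dots> = - 2 * \<i> * ba * ((ab * xb) * (bc * yc) - (ac * xc) * (bb * yb))"
    unfolding pm by (simp add: algebra_simps)
  also have "\<dots> = D * (2 * \<i> * (Sb * Sc * (eb - ec) + Sb * nc - Sc * nb) * ba)"
    unfolding cross by (simp add: mult_ac)
  finally show "2 * \<i> * (Sb * Sc * (eb - ec) + Sb * nc - Sc * nb) * ba
           = - \<i> * ((pb + mb) * xb * yc - (pc + mc) * xc * yb)"
    using D(2) mult_left_cancel by metis
  have "D * (\<i> * ((pb - mb) * xc * yb - (pc - mc) * xb * yc))
      = \<i> * ((D * (pb - mb)) * xc * yb - (D * (pc - mc)) * xb * yc)" by (simp add: algebra_simps)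
  also have "\<dots> = 2 * \<i> * aa * ((ab * xb) * (bc * yc) - (ac * xc) * (bb * yb))"
    unfolding pm by (simp add: algebra_simps)
  also have "\<dots> = D * (- (2 * \<i> * (Sb * Sc * (eb - ec) + Sb * nc - Sc * nb)) * aa)"
    unfolding cross by (simp add: mult_ac)
  finally show "- (2 * \<i> * (Sb * Sc * (eb - ec) + Sb * nc - Sc * nb)) * aa
           = \<i> * ((pb - mb) * xc * yb - (pc - mc) * xb * yc)"
    using D(2) mult_left_cancel by metis
qed

text \<open>Lax entries are affine in S. Index 0 gets factor 1 and, in \<open>lax_shift\<close>,
  shift 0, so that all four Pauli components have one form.\<close>

definition lax_factor :: "complex \<Rightarrow> 4 \<Rightarrow> complex \<Rightarrow> complex" where
  "lax_factor \<tau> a z = (if a = 0 then 1 else varphi \<tau> a z)"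

definition lax_shift :: "complex \<Rightarrow> (4 \<Rightarrow> complex) \<Rightarrow> 4 \<Rightarrow> complex \<Rightarrow> complex" where
  "lax_shift \<tau> \<nu> a z = (if a = 0 then 0 else \<nu> a * varphi \<tau> a (z - omega \<tau> a))"

lemma lax_entry:
  "lax \<tau> \<nu> z S $ i $ j = (\<Sum>a\<in>UNIV. (S $ a * lax_factor \<tau> a z + lax_shift \<tau> \<nu> a z) * pauli a $ i $ j)"
  by (simp add: lax_def lax_factor_def lax_shift_def cscale_def sum_4' algebra_simps)

lemma bracket_matrix_lax_entry:
  assumes "skew_biderivation P"
  shows "bracket_matrix P (lax \<tau> \<nu> z) (lax \<tau> \<nu> w) S $ (i, k) $ (j, l)
     = (\<Sum>a\<in>UNIV. \<Sum>b\<in>UNIV. P (\<lambda>x. x $ a) (\<lambda>x. x $ b) S * lax_factor \<tau> a z * lax_factor \<tau> b w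
          * pauli a $ i $ j * pauli b $ k $ l)"
proof -
  interpret skew_bider P by unfold_locales (rule assms)
  have "(\<lambda>x. lax \<tau> \<nu> z x $ i $ j) = (\<lambda>x. (\<Sum>a\<in>UNIV. (lax_factor \<tau> a z * pauli a $ i $ j) * x $ a)
      + (\<Sum>a\<in>UNIV. lax_shift \<tau> \<nu> a z * pauli a $ i $ j))" for z i j
    by (simp add: fun_eq_iff lax_entry algebra_simps sum.distrib)
  then show ?thesis
    by (simp add: bracket_matrix_def affine) (simp add: mult_ac)
qed

lemma reflection_rhs_lax_entry:
  assumes tau: "Im \<tau> > 0" and off: "off_poles \<tau> z w"
  shows "reflection_rhs (lax \<tau> \<nu> z S) (lax \<tau> \<nu> w S) (\<lambda>\<alpha>. varphi \<tau> \<alpha> (z - w)) (\<lambda>\<alpha>. varphi \<tau> \<alpha> (z + w)) $ (i, k) $ (j, l)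
     = (\<Sum>a\<in>UNIV. \<Sum>b\<in>UNIV. sklyanin_tensor (\<lambda>\<alpha>. E2 \<tau> (omega \<tau> \<alpha>)) (nu' \<tau> \<nu>) S a b
          * lax_factor \<tau> a z * lax_factor \<tau> b w * pauli a $ i $ j * pauli b $ k $ l)"
proof (rule reflection_rhs_components[OF lax_entry lax_entry])
  show "S $ 0 * lax_factor \<tau> 0 z + lax_shift \<tau> \<nu> 0 z = S $ 0 * lax_factor \<tau> 0 w + lax_shift \<tau> \<nu> 0 w"
    by (simp add: lax_factor_def lax_shift_def)
  show "sklyanin_tensor (\<lambda>\<alpha>. E2 \<tau> (omega \<tau> \<alpha>)) (nu' \<tau> \<nu>) S a a * lax_factor \<tau> a z * lax_factor \<tau> a w = 0" for a
    by (simp add: sklyanin_tensor_simps)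
next
  fix \<alpha> \<beta> \<gamma> :: 4
  assume cyc: "(\<alpha>, \<beta>, \<gamma>) \<in> {(1, 2, 3), (2, 3, 1), (3, 1, 2)}"
  then have cyc': "(\<beta>, \<gamma>, \<alpha>) \<in> {(1, 2, 3), (2, 3, 1), (3, 1, 2)}" "(\<gamma>, \<alpha>, \<beta>) \<in> {(1, 2, 3), (2, 3, 1), (3, 1, 2)}"
    by auto
  from cyc have idx: "\<alpha> \<in> {1, 2, 3}" "\<beta> \<in> {1, 2, 3}" "\<gamma> \<in> {1, 2, 3}" by auto
  then have nz0: "\<alpha> \<noteq> 0" "\<beta> \<noteq> 0" "\<gamma> \<noteq> 0" by auto
  have th: "theta \<tau> z \<noteq> 0" "theta \<tau> w \<noteq> 0" "theta \<tau> (z - w) \<noteq> 0" "theta \<tau> (z + w) \<noteq> 0"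
    "\<And>\<alpha>. \<alpha> \<in> {1, 2, 3} \<Longrightarrow> theta \<tau> (z - omega \<tau> \<alpha>) \<noteq> 0" "\<And>\<alpha>. \<alpha> \<in> {1, 2, 3} \<Longrightarrow> theta \<tau> (w - omega \<tau> \<alpha>) \<noteq> 0"
    using off unfolding off_poles_def by blast+
  have add: "varphi \<tau> \<alpha> (z + w) * (E2 \<tau> w - E2 \<tau> z)
      = varphi \<tau> \<alpha> z * varphi \<tau> \<beta> w * varphi \<tau> \<gamma> w - varphi \<tau> \<alpha> w * varphi \<tau> \<beta> z * varphi \<tau> \<gamma> z"
    if "(\<alpha>, \<beta>, \<gamma>) \<in> {(1, 2, 3), (2, 3, 1), (3, 1, 2)}" for \<alpha> \<beta> \<gamma>
    by (rule varphi_addition[OF tau that th(1,2,4)])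
  \<comment> \<open>The addition formula at - w: \<open>E2\<close> is even, and of the odd functions
    the pair \<beta>, \<gamma> keeps its sign while \<alpha> changes it.\<close>
  have sub: "varphi \<tau> \<alpha> (z - w) * (E2 \<tau> w - E2 \<tau> z)
      = varphi \<tau> \<alpha> z * varphi \<tau> \<beta> w * varphi \<tau> \<gamma> w + varphi \<tau> \<alpha> w * varphi \<tau> \<beta> z * varphi \<tau> \<gamma> z"
    if c: "(\<alpha>, \<beta>, \<gamma>) \<in> {(1, 2, 3), (2, 3, 1), (3, 1, 2)}" for \<alpha> \<beta> \<gamma>
  proof -
    have "theta \<tau> (- w) \<noteq> 0" "theta \<tau> (z + - w) \<noteq> 0" using th by (simp_all add: theta_minus)
    note * = varphi_addition[OF tau c th(1) this]
    have "\<alpha> \<in> {1, 2, 3}" "\<beta> \<in> {1, 2, 3}" "\<gamma> \<in> {1, 2, 3}" using c by auto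
    note ** = this[THEN varphi_minus[OF tau]]
    show ?thesis using * unfolding ** E2_minus[OF tau th(2)] by simp
  qed
  have "E2 \<tau> w - E2 \<tau> z \<noteq> 0"
  proof -
    have "w - z = - (z - w)" by simp
    then have "theta \<tau> (w - z) \<noteq> 0" using th(3) by (simp only: theta_minus) simp
    then show ?thesis
      unfolding E2_diff[OF tau th(2,1)] using th deriv_theta_0_nonzero[OF tau] by (simp add: add.commute)
  qed
  note ids = reflection_component_identities[OF refl this
      varphi_square[OF tau idx(1) th(1)] varphi_square[OF tau idx(2) th(1)] varphi_square[OF tau idx(3) th(1)]
      varphi_square[OF tau idx(1) th(2)] varphi_square[OF tau idx(2) th(2)] varphi_square[OF tau idx(3) th(2)]
      varphi_nonzero[OF tau idx(1) th(1) th(5)[OF idx(1)]] varphi_nonzero[OF tau idx(2) th(1) th(5)[OF idx(2)]]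
      varphi_nonzero[OF tau idx(3) th(1) th(5)[OF idx(3)]]
      varphi_nonzero[OF tau idx(1) th(2) th(6)[OF idx(1)]] varphi_nonzero[OF tau idx(2) th(2) th(6)[OF idx(2)]]
      varphi_nonzero[OF tau idx(3) th(2) th(6)[OF idx(3)]]
      add[OF cyc] add[OF cyc'(1)] add[OF cyc'(2)] sub[OF cyc] sub[OF cyc'(1)] sub[OF cyc'(2)] refl refl refl refl]
  have x: "S $ \<delta> * lax_factor \<tau> \<delta> z + lax_shift \<tau> \<nu> \<delta> z = S $ \<delta> * varphi \<tau> \<delta> z + nu' \<tau> \<nu> \<delta> / varphi \<tau> \<delta> z"
    and y: "S $ \<delta> * lax_factor \<tau> \<delta> w + lax_shift \<tau> \<nu> \<delta> w = S $ \<delta> * varphi \<tau> \<delta> w + nu' \<tau> \<nu> \<delta> / varphi \<tau> \<delta> w"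
    if "\<delta> \<in> {1, 2, 3}" for \<delta>
    using varphi_shift[OF tau that th(1) th(5)[OF that]] varphi_shift[OF tau that th(2) th(6)[OF that]] that
    by (auto simp: lax_factor_def lax_shift_def)
  have f: "lax_factor \<tau> 0 z = 1" "lax_factor \<tau> 0 w = 1" "lax_shift \<tau> \<nu> 0 w = 0"
    "lax_factor \<tau> \<alpha> z = varphi \<tau> \<alpha> z" "lax_factor \<tau> \<beta> z = varphi \<tau> \<beta> z"
    "lax_factor \<tau> \<alpha> w = varphi \<tau> \<alpha> w" "lax_factor \<tau> \<beta> w = varphi \<tau> \<beta> w"
    using nz0 by (simp_all add: lax_factor_def lax_shift_def)
  let ?T = "sklyanin_tensor (\<lambda>\<alpha>. E2 \<tau> (omega \<tau> \<alpha>)) (nu' \<tau> \<nu>) S"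
  have T: "?T \<beta> \<alpha> = - ?T \<alpha> \<beta>" "?T \<alpha> 0 = - ?T 0 \<alpha>" by (rule sklyanin_tensor_skew)+
  show "?T \<alpha> \<beta> * lax_factor \<tau> \<alpha> z * lax_factor \<tau> \<beta> w
      = \<i> * (S $ 0 * lax_factor \<tau> 0 w + lax_shift \<tau> \<nu> 0 w) *
        ((varphi \<tau> \<alpha> (z + w) + varphi \<tau> \<alpha> (z - w)) * (S $ \<gamma> * lax_factor \<tau> \<gamma> w + lax_shift \<tau> \<nu> \<gamma> w)
       + (varphi \<tau> \<beta> (z + w) - varphi \<tau> \<beta> (z - w)) * (S $ \<gamma> * lax_factor \<tau> \<gamma> z + lax_shift \<tau> \<nu> \<gamma> z)) \<and>
    ?T \<beta> \<alpha> * lax_factor \<tau> \<beta> z * lax_factor \<tau> \<alpha> w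
      = - \<i> * (S $ 0 * lax_factor \<tau> 0 w + lax_shift \<tau> \<nu> 0 w) *
        ((varphi \<tau> \<beta> (z + w) + varphi \<tau> \<beta> (z - w)) * (S $ \<gamma> * lax_factor \<tau> \<gamma> w + lax_shift \<tau> \<nu> \<gamma> w)
       + (varphi \<tau> \<alpha> (z + w) - varphi \<tau> \<alpha> (z - w)) * (S $ \<gamma> * lax_factor \<tau> \<gamma> z + lax_shift \<tau> \<nu> \<gamma> z)) \<and>
    ?T 0 \<alpha> * lax_factor \<tau> 0 z * lax_factor \<tau> \<alpha> w
      = - \<i> * ((varphi \<tau> \<beta> (z + w) + varphi \<tau> \<beta> (z - w)) * (S $ \<beta> * lax_factor \<tau> \<beta> z + lax_shift \<tau> \<nu> \<beta> z)
            * (S $ \<gamma> * lax_factor \<tau> \<gamma> w + lax_shift \<tau> \<nu> \<gamma> w)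
          - (varphi \<tau> \<gamma> (z + w) + varphi \<tau> \<gamma> (z - w)) * (S $ \<gamma> * lax_factor \<tau> \<gamma> z + lax_shift \<tau> \<nu> \<gamma> z)
            * (S $ \<beta> * lax_factor \<tau> \<beta> w + lax_shift \<tau> \<nu> \<beta> w)) \<and>
    ?T \<alpha> 0 * lax_factor \<tau> \<alpha> z * lax_factor \<tau> 0 w
      = \<i> * ((varphi \<tau> \<beta> (z + w) - varphi \<tau> \<beta> (z - w)) * (S $ \<gamma> * lax_factor \<tau> \<gamma> z + lax_shift \<tau> \<nu> \<gamma> z)
            * (S $ \<beta> * lax_factor \<tau> \<beta> w + lax_shift \<tau> \<nu> \<beta> w)
          - (varphi \<tau> \<gamma> (z + w) - varphi \<tau> \<gamma> (z - w)) * (S $ \<beta> * lax_factor \<tau> \<beta> z + lax_shift \<tau> \<nu> \<beta> z)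
            * (S $ \<gamma> * lax_factor \<tau> \<gamma> w + lax_shift \<tau> \<nu> \<gamma> w))"
    unfolding x[OF idx(2)] x[OF idx(3)] y[OF idx(2)] y[OF idx(3)]
    unfolding T
      sklyanin_tensor_simps(2)[OF cyc] sklyanin_tensor_simps(3)[OF cyc] f mult_1_right add_0_right
    by (intro conjI ids)
qed

lemma reflection_equation_iff:
  assumes tau: "Im \<tau> > 0" and P: "skew_biderivation P"
  shows "reflection_equation \<tau> \<nu> P \<longleftrightarrow>
    (\<forall>a b S. P (\<lambda>x. x $ a) (\<lambda>x. x $ b) S = sklyanin_tensor (\<lambda>\<alpha>. E2 \<tau> (omega \<tau> \<alpha>)) (nu' \<tau> \<nu>) S a b)"
    (is "_ \<longleftrightarrow> (\<forall>a b S. ?P a b S = ?T S a b)")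
proof -
  have refl_eq: "reflection_equation \<tau> \<nu> P \<longleftrightarrow> (\<forall>z w S. off_poles \<tau> z w \<longrightarrow>
      bracket_matrix P (lax \<tau> \<nu> z) (lax \<tau> \<nu> w) S =
      reflection_rhs (lax \<tau> \<nu> z S) (lax \<tau> \<nu> w S) (\<lambda>\<alpha>. varphi \<tau> \<alpha> (z - w)) (\<lambda>\<alpha>. varphi \<tau> \<alpha> (z + w)))"
    unfolding reflection_equation_def reflection_rhs_def r_minus_def r_plus_def Let_def ..
  show ?thesis
  proof
    assume "\<forall>a b S. ?P a b S = ?T S a b"
    then show "reflection_equation \<tau> \<nu> P"
      unfolding refl_eq vec_eq_iff split_paired_All
      by (simp add: bracket_matrix_lax_entry[OF P] reflection_rhs_lax_entry[OF tau])
  next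
    assume R: "reflection_equation \<tau> \<nu> P"
    obtain z w where off: "off_poles \<tau> z w" using off_poles_exists[OF tau] by blast
    \<comment> \<open>The zeros of varphi_\<alpha>(z) are zeros of theta(z - omega_\<alpha>), which
      \<open>off_poles\<close> excludes.\<close>
    have factor: "lax_factor \<tau> a z \<noteq> 0 \<and> lax_factor \<tau> a w \<noteq> 0" for a
    proof -
      have "\<forall>a. lax_factor \<tau> a z \<noteq> 0 \<and> lax_factor \<tau> a w \<noteq> 0"
        unfolding forall_4' using off
        by (simp add: lax_factor_def off_poles_def varphi_nonzero[OF tau])
      then show ?thesis by blast
    qed
    have "(?P a b S - ?T S a b) * lax_factor \<tau> a z * lax_factor \<tau> b w = 0" for a b S
    proof (rule pauli_kron_independent)
      fix i j k l
      have "bracket_matrix P (lax \<tau> \<nu> z) (lax \<tau> \<nu> w) S $ (i, k) $ (j, l) =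
        reflection_rhs (lax \<tau> \<nu> z S) (lax \<tau> \<nu> w S) (\<lambda>\<alpha>. varphi \<tau> \<alpha> (z - w)) (\<lambda>\<alpha>. varphi \<tau> \<alpha> (z + w)) $ (i, k) $ (j, l)"
        using R off unfolding refl_eq by simp
      then show "(\<Sum>a\<in>UNIV. \<Sum>b\<in>UNIV. (?P a b S - ?T S a b) * lax_factor \<tau> a z * lax_factor \<tau> b w
          * pauli a $ i $ j * pauli b $ k $ l) = 0"
        unfolding bracket_matrix_lax_entry[OF P] reflection_rhs_lax_entry[OF tau off]
        by (simp add: left_diff_distrib sum_subtractf)
    qed
    then show "\<forall>a b S. ?P a b S = ?T S a b"
      using factor by simp
  qed
qed

text \<open>Degree at most two as a predicate on single functions: closed under sums and scalar
  multiples, so the tensor is handled summand by summand instead of through explicit coefficient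
  arrays.\<close>

definition quadratic_fun :: "(complex ^ 4 \<Rightarrow> complex) \<Rightarrow> bool" where
  "quadratic_fun F \<longleftrightarrow> (\<exists>(q :: 4 \<Rightarrow> 4 \<Rightarrow> complex) (l :: 4 \<Rightarrow> complex) (k :: complex). \<forall>S.
     F S = (\<Sum>c\<in>UNIV. \<Sum>d\<in>UNIV. q c d * S $ c * S $ d) + (\<Sum>c\<in>UNIV. l c * S $ c) + k)"

lemma quadratic_fun_const: "quadratic_fun (\<lambda>S. k)"
  unfolding quadratic_fun_def
  by (rule exI[of _ "\<lambda>_ _. 0"], rule exI[of _ "\<lambda>_. 0"], rule exI[of _ k]) simp

lemma quadratic_fun_coord: "quadratic_fun (\<lambda>S. S $ a)"
  unfolding quadratic_fun_def
  by (rule exI[of _ "\<lambda>_ _. 0"], rule exI[of _ "\<lambda>c. if c = a then 1 else 0"], rule exI[of _ 0])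
     (simp add: if_distrib[of "\<lambda>t. t * _"] cong: if_cong)

lemma quadratic_fun_square: "quadratic_fun (\<lambda>S. S $ a * S $ b)"
proof -
  have "(\<Sum>d\<in>UNIV. (if c = a \<and> d = b then 1 else 0) * S $ c * S $ d) = (if c = a then S $ a * S $ b else 0)"
    for c and S :: "complex ^ 4"
    by (simp add: if_distrib[of "\<lambda>t. t * _"] cong: if_cong)
  then show ?thesis
    unfolding quadratic_fun_def
    by (intro exI[of _ "\<lambda>c d. if c = a \<and> d = b then 1 else 0"] exI[of _ "\<lambda>_. 0"] exI[of _ 0]) simp
qed

lemma quadratic_fun_add:
  assumes "quadratic_fun F" "quadratic_fun G"
  shows "quadratic_fun (\<lambda>S. F S + G S)"
proof -
  obtain q l k q' l' k' where
    "\<And>S. F S = (\<Sum>c\<in>UNIV. \<Sum>d\<in>UNIV. q c d * S $ c * S $ d) + (\<Sum>c\<in>UNIV. l c * S $ c) + k"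
    "\<And>S. G S = (\<Sum>c\<in>UNIV. \<Sum>d\<in>UNIV. q' c d * S $ c * S $ d) + (\<Sum>c\<in>UNIV. l' c * S $ c) + k'"
    using assms unfolding quadratic_fun_def by blast
  then show ?thesis
    unfolding quadratic_fun_def
    by (intro exI[of _ "\<lambda>c d. q c d + q' c d"] exI[of _ "\<lambda>c. l c + l' c"] exI[of _ "k + k'"])
       (simp add: distrib_right sum.distrib)
qed

lemma quadratic_fun_scale:
  assumes "quadratic_fun F"
  shows "quadratic_fun (\<lambda>S. r * F S)"
proof -
  obtain q l k where
    "\<And>S. F S = (\<Sum>c\<in>UNIV. \<Sum>d\<in>UNIV. q c d * S $ c * S $ d) + (\<Sum>c\<in>UNIV. l c * S $ c) + k"
    using assms unfolding quadratic_fun_def by blast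
  then show ?thesis
    unfolding quadratic_fun_def
    by (intro exI[of _ "\<lambda>c d. r * q c d"] exI[of _ "\<lambda>c. r * l c"] exI[of _ "r * k"])
       (simp add: distrib_left sum_distrib_left mult.assoc)
qed

lemma quadratic_fun_sum:
  "(\<And>i. i \<in> I \<Longrightarrow> quadratic_fun (F i)) \<Longrightarrow> quadratic_fun (\<lambda>S. \<Sum>i\<in>I. F i S)"
  by (induction I rule: infinite_finite_induct) (simp_all add: quadratic_fun_const quadratic_fun_add)

lemma sklyanin_tensor_quadratic: "quadratic_fun (\<lambda>S. sklyanin_tensor e n S a b)"
proof -
  note rules = quadratic_fun_sum quadratic_fun_add quadratic_fun_scale quadratic_fun_square quadratic_fun_coord
  define F where "F \<alpha> = (\<lambda>S. \<Sum>\<beta>\<in>{1, 2, 3}. \<Sum>\<gamma>\<in>{1, 2, 3}.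
            (\<i> * levi_civita \<alpha> \<beta> \<gamma> * (e \<beta> - e \<gamma>)) * (S $ \<beta> * S $ \<gamma>)
            + (2 * \<i> * levi_civita \<alpha> \<beta> \<gamma> * n \<gamma>) * S $ \<beta>)" for \<alpha> and S :: "complex ^ 4"
  define G where "G = (\<lambda>S :: complex ^ 4. 2 * \<i> * (\<Sum>\<gamma>\<in>{1, 2, 3}. levi_civita a b \<gamma> * (S $ 0 * S $ \<gamma>)))"
  have "quadratic_fun (F \<alpha>)" for \<alpha>
    unfolding F_def by (intro rules)
  moreover from this have "quadratic_fun (\<lambda>S. - 1 * F \<alpha> S)" for \<alpha>
    by (rule quadratic_fun_scale)
  moreover have "quadratic_fun G"
    unfolding G_def by (intro rules)
  moreover have "(\<lambda>S. sklyanin_tensor e n S a b)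
      = (if a = 0 then (if b = 0 then (\<lambda>S. 0) else F b) else if b = 0 then (\<lambda>S. - 1 * F a S) else G)"
    by (auto simp: sklyanin_tensor_def F_def G_def mult_ac)
  ultimately show ?thesis
    by (simp add: quadratic_fun_const)
qed

theorem proposition8p2:
  fixes \<tau> :: complex and \<nu> :: "4 \<Rightarrow> complex"
  assumes "Im \<tau> > 0"
  shows
    "(\<exists>P. poisson_bracket P \<and> quadratic_bracket P \<and> reflection_equation \<tau> \<nu> P) \<and>
     (\<forall>P Q. skew_biderivation P \<and> reflection_equation \<tau> \<nu> P \<and>
            skew_biderivation Q \<and> reflection_equation \<tau> \<nu> Q \<longrightarrow>
            (\<forall>f\<in>polyfuns. \<forall>g\<in>polyfuns. P f g = Q f g)) \<and>
     (\<forall>P. skew_biderivation P \<longrightarrow>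
        (reflection_equation \<tau> \<nu> P \<longleftrightarrow>
           (\<forall>\<alpha>\<in>{1, 2, 3}. \<forall>\<beta>\<in>{1, 2, 3}. \<forall>S.
              P (\<lambda>x. x $ \<alpha>) (\<lambda>x. x $ \<beta>) S
                = 2 * \<i> * (\<Sum>\<gamma>\<in>{1, 2, 3}. levi_civita \<alpha> \<beta> \<gamma> * S $ 0 * S $ \<gamma>)) \<and>
           (\<forall>\<alpha>\<in>{1, 2, 3}. \<forall>S.
              P (\<lambda>x. x $ 0) (\<lambda>x. x $ \<alpha>) S
                = (\<Sum>\<beta>\<in>{1, 2, 3}. \<Sum>\<gamma>\<in>{1, 2, 3}.
                     \<i> * levi_civita \<alpha> \<beta> \<gamma> * S $ \<beta> * S $ \<gamma>
                         * (E2 \<tau> (omega \<tau> \<beta>) - E2 \<tau> (omega \<tau> \<gamma>))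
                     + 2 * \<i> * levi_civita \<alpha> \<beta> \<gamma> * S $ \<beta> * nu' \<tau> \<nu> \<gamma>))))"
    (is "?exists \<and> ?unique \<and> (\<forall>P. _ \<longrightarrow> (_ \<longleftrightarrow> ?formulas P))")
proof (intro conjI)
  let ?T = "sklyanin_tensor (\<lambda>\<alpha>. E2 \<tau> (omega \<tau> \<alpha>)) (nu' \<tau> \<nu>)"
  let ?B = "bivector_bracket ?T"
  have poisson: "poisson_bracket ?B" by (rule sklyanin_bracket_poisson)
  then have "skew_biderivation ?B" by (simp only: poisson_bracket_def)
  then have "reflection_equation \<tau> \<nu> ?B"
    unfolding reflection_equation_iff[OF assms \<open>skew_biderivation ?B\<close>] bivector_bracket_coord by blast
  moreover have "quadratic_bracket ?B"
    unfolding quadratic_bracket_def bivector_bracket_coord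
    using sklyanin_tensor_quadratic unfolding quadratic_fun_def by (intro allI)
  ultimately show ?exists using poisson by blast
  show ?unique
  proof (intro allI impI ballI; elim conjE)
    fix P Q f g
    assume P: "skew_biderivation P" "reflection_equation \<tau> \<nu> P"
      and Q: "skew_biderivation Q" "reflection_equation \<tau> \<nu> Q"
      and fg: "f \<in> polyfuns" "g \<in> polyfuns"
    show "P f g = Q f g"
      using P(2) Q(2) unfolding reflection_equation_iff[OF assms P(1)] reflection_equation_iff[OF assms Q(1)]
      by (intro skew_biderivation_determined[OF P(1) Q(1) _ fg]) simp
  qed
  show "\<forall>P. skew_biderivation P \<longrightarrow> (reflection_equation \<tau> \<nu> P \<longleftrightarrow> ?formulas P)"
  proof (intro allI impI)
    fix P
    assume P: "skew_biderivation P"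
    interpret skew_bider P by unfold_locales (rule P)
    have tensor: "?T S \<alpha> \<beta> = 2 * \<i> * (\<Sum>\<gamma>\<in>{1, 2, 3}. levi_civita \<alpha> \<beta> \<gamma> * S $ 0 * S $ \<gamma>)"
      "?T S 0 \<alpha> = (\<Sum>\<beta>\<in>{1, 2, 3}. \<Sum>\<gamma>\<in>{1, 2, 3}.
                     \<i> * levi_civita \<alpha> \<beta> \<gamma> * S $ \<beta> * S $ \<gamma>
                         * (E2 \<tau> (omega \<tau> \<beta>) - E2 \<tau> (omega \<tau> \<gamma>))
                     + 2 * \<i> * levi_civita \<alpha> \<beta> \<gamma> * S $ \<beta> * nu' \<tau> \<nu> \<gamma>)"
      if "\<alpha> \<in> {1, 2, 3}" "\<beta> \<in> {1, 2, 3}" for \<alpha> \<beta> S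
    proof -
      have "\<alpha> \<noteq> 0" "\<beta> \<noteq> 0" using that by auto
      then show "?T S \<alpha> \<beta> = 2 * \<i> * (\<Sum>\<gamma>\<in>{1, 2, 3}. levi_civita \<alpha> \<beta> \<gamma> * S $ 0 * S $ \<gamma>)"
        "?T S 0 \<alpha> = (\<Sum>\<beta>\<in>{1, 2, 3}. \<Sum>\<gamma>\<in>{1, 2, 3}.
                     \<i> * levi_civita \<alpha> \<beta> \<gamma> * S $ \<beta> * S $ \<gamma>
                         * (E2 \<tau> (omega \<tau> \<beta>) - E2 \<tau> (omega \<tau> \<gamma>))
                     + 2 * \<i> * levi_civita \<alpha> \<beta> \<gamma> * S $ \<beta> * nu' \<tau> \<nu> \<gamma>)"
        by (simp_all only: sklyanin_tensor_def Let_def if_False if_True simp_thms)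
    qed
    have "?formulas P \<longleftrightarrow>
        (\<forall>\<alpha>\<in>{1, 2, 3}. \<forall>\<beta>\<in>{1, 2, 3}. \<forall>S. P (\<lambda>x. x $ \<alpha>) (\<lambda>x. x $ \<beta>) S = ?T S \<alpha> \<beta>) \<and>
        (\<forall>\<alpha>\<in>{1, 2, 3}. \<forall>S. P (\<lambda>x. x $ 0) (\<lambda>x. x $ \<alpha>) S = ?T S 0 \<alpha>)"
      by (simp only: tensor cong: ball_cong)
    \<comment> \<open>The formulas leave out the pairs (0, 0) and (\<alpha>, 0); skewness of both
      sides supplies them.\<close>
    also have "\<dots> \<longleftrightarrow> (\<forall>a b S. P (\<lambda>x. x $ a) (\<lambda>x. x $ b) S = ?T S a b)"
    proof (intro iffI conjI allI)
      fix a b S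
      assume *: "(\<forall>\<alpha>\<in>{1, 2, 3}. \<forall>\<beta>\<in>{1, 2, 3}. \<forall>S. P (\<lambda>x. x $ \<alpha>) (\<lambda>x. x $ \<beta>) S = ?T S \<alpha> \<beta>) \<and>
        (\<forall>\<alpha>\<in>{1, 2, 3}. \<forall>S. P (\<lambda>x. x $ 0) (\<lambda>x. x $ \<alpha>) S = ?T S 0 \<alpha>)"
      have nz: "\<alpha> \<in> {1, 2, 3}" if "\<alpha> \<noteq> 0" for \<alpha> :: 4
        using UNIV_4' that by blast
      have sk: "P (\<lambda>x. x $ a) (\<lambda>x. x $ b) S = - P (\<lambda>x. x $ b) (\<lambda>x. x $ a) S" for a b
        using skew[of "\<lambda>x. x $ a" "\<lambda>x. x $ b"] by (simp add: fun_eq_iff)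
      show "P (\<lambda>x. x $ a) (\<lambda>x. x $ b) S = ?T S a b"
      proof (cases "a = 0"; cases "b = 0")
        assume "a = 0" "b = 0"
        then show ?thesis using sk[of 0 0] by (simp add: sklyanin_tensor_simps)
      next
        assume "a = 0" "b \<noteq> 0"
        then show ?thesis using * nz by blast
      next
        assume "a \<noteq> 0" "b = 0"
        then have "P (\<lambda>x. x $ b) (\<lambda>x. x $ a) S = ?T S b a" using * nz by blast
        then show ?thesis using sk[of a b] sklyanin_tensor_skew[of _ _ S a b] by metis
      next
        assume "a \<noteq> 0" "b \<noteq> 0"
        then show ?thesis using * nz by blast
      qed
    qed auto
    finally show "reflection_equation \<tau> \<nu> P \<longleftrightarrow> ?formulas P"
      unfolding reflection_equation_iff[OF assms P] by blast
  qed
qed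

end
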